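(* Consider, in the phase space $\mathcal C=C_g^0(\mathbb R^n)$, the system $$x_i'(t)=-\sum_{j=1}^n d_{ij}(t)x_j(t)+\sum_{j=1}^n a_{ij}(t)\int_{-\tau_{ij}(t)}^0 x_j(t+s)\,d_s\nu_{ij}(t,s),\qquad i=1,\dots,n,\ t\ge0,\qquad( * )$$ with $\tau_{ij}:[0,\infty)\to[0,\infty)$ continuous (possibly unbounded), and set $\tau(t)=\max_{1\le i,j\le n}\tau_{ij}(t)$. Assume that the functions $d_{ij}:[0,\infty)\to\mathbb R$ and the maps $L_{ij}:[0,\infty)\to L(C_g^0(\mathbb R),\mathbb R)$, $L_{ij}(t)\psi=a_{ij}(t)\int_{-\tau_{ij}(t)}^0\psi(s)\,d_s\nu_{ij}(t,s)$, are continuous, where the bounded variation functions $\nu_{ij}(t,\cdot):[-\tau_{ij}(t),0]\to\mathbb R$ satisfy $$\int_{-\tau_{ij}(t)}^0 g(s)\,d_s|\nu_{ij}|(t,s)=1,\qquad t\ge0,\ i,j=1,\dots,n.$$ In addition, suppose that $\tau(t)\le t$ for all sufficiently large $t$ and that there exist a measurable, locally integrable function $e:\mathbb R\to[0,\infty)$, a vector $v>0$ in $\mathbb R^n$ and $T\ge0$ such that: (i) $\Big[\widehat D(t)-e^{\int_{t-\tau(t)}^t e(u)\,du}A(t)-e(t)I\Big]v\ge0$ for $t\ge T$, where $I$ is the $n\times n$ identity matrix; (ii) $\int_0^\infty e(t)\,dt=\infty$. Then $( * )$ is asymptotically stable.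
   Context: Phase space: $g:(-\infty,0]\to[1,\infty)$ is a fixed nonincreasing continuous function with $g(0)=1$, $\lim_{s\to-\infty}g(s)=\infty$ and $\lim_{u\to0^-}g(s+u)/g(s)=1$ uniformly for $s\in(-\infty,0]$. For $m\in\mathbb N$, $C_g^0(\mathbb R^m)$ is the Banach space of continuous $\phi:(-\infty,0]\to\mathbb R^m$ with $\lim_{s\to-\infty}|\phi(s)|/g(s)=0$, with norm $\|\phi\|=\|\phi\|_g=\sup_{s\le0}|\phi(s)|/g(s)$, where $|x|=\max_i|x_i|$. $L(C_g^0(\mathbb R),\mathbb R)$ is the dual of $C_g^0(\mathbb R)$ with the operator norm. $x_t(s)=x(t+s)$ for $s\le0$. $|\nu_{ij}|(t,\cdot)$ is the total variation measure of $d_s\nu_{ij}(t,s)$; the normalization gives $a_{ij}(t)=\|L_{ij}(t)\|\ge0$. $\widehat D(t)=[\hat d_{ij}(t)]$ with $\hat d_{ii}(t)=d_{ii}(t)$, $\hat d_{ij}(t)=-|d_{ij}(t)|$ for $i\ne j$; $A(t)=[a_{ij}(t)]$. Vector inequalities are componentwise; $v>0$ means all components are positive. In $e^{\int\cdots}$, the base $e$ is the exponential constant, while $e(\cdot)$ is the given function. For $\sigma\ge0$, $\phi\in\mathcal C$, $x(t,\sigma,\phi)$, $t\ge\sigma$, is the solution with $x_\sigma=\phi$, and $x_t(\sigma,\phi)$ its history in $\mathcal C$. The system is stable on $[\alpha,\infty)$ if for every $\varepsilon>0$ and $\sigma\ge\alpha$ there is $\delta=\delta(\varepsilon,\sigma)>0$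 such that $\|\phi\|<\delta$ implies $\|x_t(\sigma,\phi)\|<\varepsilon$ for all $t\ge\sigma$. It is asymptotically stable if it is stable on some interval $[\alpha,\infty)\subset[0,\infty)$ and $\lim_{t\to\infty}x(t,\sigma,\phi)=0$ for all $\sigma\ge0$, $\phi\in\mathcal C$. *)

theory Defs
  imports "HOL-Analysis.Analysis"
begin

section \<open>Phase space\<close>

definition phase_weight :: "(real \<Rightarrow> real) \<Rightarrow> bool" where
  "phase_weight g \<longleftrightarrow>
     continuous_on {..0} g \<and> (\<forall>s\<le>0. 1 \<le> g s) \<and> antimono_on {..0} g \<and> g 0 = 1 \<and>
     filterlim g at_top at_bot \<and>
     uniform_limit {..0} (\<lambda>u s. g (s + u) / g s) (\<lambda>s. 1) (at_left 0)"

text \<open>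
  A function on \<open>(-\<infinity>, 0]\<close> is a total function whose values on \<open>(0, \<infinity>)\<close> are irrelevant.
  The norm \<open>max\<^sub>i \<bar>x\<^sub>i\<bar>\<close> is \<^const>\<open>infnorm\<close>; on \<^typ>\<open>real\<close> it is the absolute value, so that the
  definitions below cover both \<open>C\<^sub>g\<^sup>0(\<real>\<^sup>n)\<close> and \<open>C\<^sub>g\<^sup>0(\<real>)\<close>.
\<close>

definition Cg0 :: "(real \<Rightarrow> real) \<Rightarrow> (real \<Rightarrow> 'a::euclidean_space) set" where
  "Cg0 g = {\<phi>. continuous_on {..0} \<phi> \<and> ((\<lambda>s. infnorm (\<phi> s) / g s) \<longlongrightarrow> 0) at_bot}"

definition gnorm :: "(real \<Rightarrow> real) \<Rightarrow> (real \<Rightarrow> 'a::euclidean_space) \<Rightarrow> real" where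
  "gnorm g \<phi> = (SUP s\<in>{..0}. infnorm (\<phi> s) / g s)"

definition Cg0_dual :: "(real \<Rightarrow> real) \<Rightarrow> ((real \<Rightarrow> real) \<Rightarrow> real) set" where
  "Cg0_dual g = {\<Lambda>.
     (\<forall>\<phi>\<in>Cg0 g. \<forall>\<psi>\<in>Cg0 g. \<Lambda> (\<lambda>s. \<phi> s + \<psi> s) = \<Lambda> \<phi> + \<Lambda> \<psi>) \<and>
     (\<forall>c. \<forall>\<phi>\<in>Cg0 g. \<Lambda> (\<lambda>s. c * \<phi> s) = c * \<Lambda> \<phi>) \<and>
     (\<exists>K. \<forall>\<phi>\<in>Cg0 g. \<bar>\<Lambda> \<phi>\<bar> \<le> K * gnorm g \<phi>)}"

definition dual_norm :: "(real \<Rightarrow> real) \<Rightarrow> ((real \<Rightarrow> real) \<Rightarrow> real) \<Rightarrow> real" where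
  "dual_norm g \<Lambda> = (SUP \<psi>\<in>{\<psi>\<in>Cg0 g. gnorm g \<psi> \<le> 1}. \<bar>\<Lambda> \<psi>\<bar>)"

definition dual_continuous ::
  "(real \<Rightarrow> real) \<Rightarrow> (real \<Rightarrow> (real \<Rightarrow> real) \<Rightarrow> real) \<Rightarrow> bool" where
  "dual_continuous g L \<longleftrightarrow>
     (\<forall>t\<ge>0. L t \<in> Cg0_dual g) \<and>
     (\<forall>t\<ge>0. ((\<lambda>r. dual_norm g (\<lambda>\<psi>. L r \<psi> - L t \<psi>)) \<longlongrightarrow> 0) (at t within {0..}))"

section \<open>Lebesgue-Stieltjes integration\<close>

definition variation_sums :: "(real \<Rightarrow> real) \<Rightarrow> real set \<Rightarrow> real set" where
  "variation_sums f S =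
     {(\<Sum>k<m. \<bar>f (u (Suc k)) - f (u k)\<bar>) | u m. (\<forall>k\<le>m. u k \<in> S) \<and> (\<forall>k<m. u k \<le> u (Suc k))}"

definition bounded_variation_on :: "real set \<Rightarrow> (real \<Rightarrow> real) \<Rightarrow> bool" where
  "bounded_variation_on S f \<longleftrightarrow> bdd_above (variation_sums f S)"

definition total_variation :: "(real \<Rightarrow> real) \<Rightarrow> real set \<Rightarrow> real" where
  "total_variation f S = Sup (variation_sums f S)"

text \<open>
  The signed Borel measure \<open>df\<close> of a function \<open>f\<close> of bounded variation on the real line satisfies
  \<open>df(a,b] = f(b+) - f(a+)\<close> and does not depend on the values of \<open>f\<close> at its (countably many)
  discontinuities. Hence \<open>f\<close> is first replaced by its right limits; without this step an
  isolated value of \<open>f\<close> would contribute to the variation, though not to \<open>df\<close>.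
  The total variation measure \<open>\<bar>df\<bar>\<close> and the positive and negative parts of \<open>df\<close> (Jordan
  decomposition) then have the distribution functions \<open>V\<close>, \<open>(V + f\<^sup>+) / 2\<close> and \<open>(V - f\<^sup>+) / 2\<close>,
  where \<open>f\<^sup>+\<close> is the right regularization and \<open>V(s)\<close> its variation on \<open>(-\<infinity>, s]\<close>.
\<close>

definition right_reg :: "(real \<Rightarrow> real) \<Rightarrow> real \<Rightarrow> real" where
  "right_reg f s = Lim (at_right s) f"

definition variation_fun :: "(real \<Rightarrow> real) \<Rightarrow> real \<Rightarrow> real" where
  "variation_fun f s = total_variation (right_reg f) {..s}"

definition variation_measure :: "(real \<Rightarrow> real) \<Rightarrow> real measure" where
  "variation_measure f = interval_measure (variation_fun f)"

definition pos_variation_measure :: "(real \<Rightarrow> real) \<Rightarrow> real measure" where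
  "pos_variation_measure f = interval_measure (\<lambda>s. (variation_fun f s + right_reg f s) / 2)"

definition neg_variation_measure :: "(real \<Rightarrow> real) \<Rightarrow> real measure" where
  "neg_variation_measure f = interval_measure (\<lambda>s. (variation_fun f s - right_reg f s) / 2)"

definition stieltjes_integral :: "(real \<Rightarrow> real) \<Rightarrow> real set \<Rightarrow> (real \<Rightarrow> real) \<Rightarrow> real" where
  "stieltjes_integral f S \<psi> =
     (LINT s:S|pos_variation_measure f. \<psi> s) - (LINT s:S|neg_variation_measure f. \<psi> s)"

section \<open>Linear delay differential systems and stability\<close>

text \<open>
  In \<open>\<integral>\<^bsub>[-\<tau>,0]\<^esub> \<psi>(s) d\<^sub>s\<nu>(t,s)\<close> the integrator \<open>\<nu>(t,\<cdot>)\<close> is a function of bounded variation on the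
  whole line and the integral runs over the closed interval. A function given on \<open>[-\<tau>,0]\<close> only
  is to be extended by its two end point values; other extensions just allow one to prescribe
  the atoms of \<open>d\<^sub>s\<nu>\<close> at the end points through the limits \<open>\<nu>(-\<tau>-)\<close> and \<open>\<nu>(0+)\<close>.
  In particular \<open>\<psi>(0)\<close>, an atom at 0, can be represented when the delay \<open>\<tau>(t)\<close> vanishes.
\<close>

definition delay_op ::
  "(real \<Rightarrow> real) \<Rightarrow> (real \<Rightarrow> real) \<Rightarrow> (real \<Rightarrow> real \<Rightarrow> real) \<Rightarrow> real \<Rightarrow> (real \<Rightarrow> real) \<Rightarrow> real" where
  "delay_op a \<tau> \<nu> t \<psi> = a t * stieltjes_integral (\<nu> t) {- \<tau> t..0} \<psi>"

definition system_rhs ::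
  "('n \<Rightarrow> 'n \<Rightarrow> real \<Rightarrow> real) \<Rightarrow> ('n \<Rightarrow> 'n \<Rightarrow> real \<Rightarrow> (real \<Rightarrow> real) \<Rightarrow> real) \<Rightarrow>
   real \<Rightarrow> (real \<Rightarrow> real ^ 'n) \<Rightarrow> real ^ 'n::finite" where
  "system_rhs d L t \<psi> =
     (\<chi> i. - (\<Sum>j\<in>UNIV. d i j t * \<psi> 0 $ j) + (\<Sum>j\<in>UNIV. L i j t (\<lambda>s. \<psi> s $ j)))"

definition hist :: "(real \<Rightarrow> 'a) \<Rightarrow> real \<Rightarrow> real \<Rightarrow> 'a" where
  "hist x t = (\<lambda>s. x (t + s))"

text \<open>\<open>x\<close> solves \<open>x'(t) = F(t, x\<^sub>t)\<close> for \<open>t \<ge> \<sigma>\<close> (one-sided derivative at \<open>\<sigma>\<close>) with \<open>x\<^sub>\<sigma> = \<phi>\<close>.\<close>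

definition fde_solution ::
  "(real \<Rightarrow> (real \<Rightarrow> 'a) \<Rightarrow> 'a) \<Rightarrow> real \<Rightarrow> (real \<Rightarrow> 'a) \<Rightarrow> (real \<Rightarrow> 'a::euclidean_space) \<Rightarrow> bool" where
  "fde_solution F \<sigma> \<phi> x \<longleftrightarrow>
     (\<forall>s\<le>0. hist x \<sigma> s = \<phi> s) \<and>
     (\<forall>t\<ge>\<sigma>. (x has_vector_derivative F t (hist x t)) (at t within {\<sigma>..}))"

definition stable_from ::
  "(real \<Rightarrow> real) \<Rightarrow> (real \<Rightarrow> (real \<Rightarrow> 'a) \<Rightarrow> 'a::euclidean_space) \<Rightarrow> real \<Rightarrow> bool" where
  "stable_from g F \<alpha> \<longleftrightarrow>
     (\<forall>\<epsilon>>0. \<forall>\<sigma>\<ge>\<alpha>. \<exists>\<delta>>0. \<forall>\<phi>\<in>Cg0 g. gnorm g \<phi> < \<delta> \<longrightarrow>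
        (\<forall>x. fde_solution F \<sigma> \<phi> x \<longrightarrow> (\<forall>t\<ge>\<sigma>. gnorm g (hist x t) < \<epsilon>)))"

definition asymptotically_stable ::
  "(real \<Rightarrow> real) \<Rightarrow> (real \<Rightarrow> (real \<Rightarrow> 'a) \<Rightarrow> 'a::euclidean_space) \<Rightarrow> bool" where
  "asymptotically_stable g F \<longleftrightarrow>
     (\<exists>\<alpha>\<ge>0. stable_from g F \<alpha>) \<and>
     (\<forall>\<sigma>\<ge>0. \<forall>\<phi>\<in>Cg0 g. \<forall>x. fde_solution F \<sigma> \<phi> x \<longrightarrow> (x \<longlongrightarrow> 0) at_top)"

definition max_delay :: "('n::finite \<Rightarrow> 'n \<Rightarrow> real \<Rightarrow> real) \<Rightarrow> real \<Rightarrow> real" where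
  "max_delay \<tau> t = Max {\<tau> i j t | i j. True}"

definition D_hat :: "('n::finite \<Rightarrow> 'n \<Rightarrow> real \<Rightarrow> real) \<Rightarrow> real \<Rightarrow> real ^ 'n ^ 'n" where
  "D_hat d t = (\<chi> i j. if i = j then d i i t else - \<bar>d i j t\<bar>)"

definition coeff_matrix :: "('n::finite \<Rightarrow> 'n \<Rightarrow> real \<Rightarrow> real) \<Rightarrow> real \<Rightarrow> real ^ 'n ^ 'n" where
  "coeff_matrix a t = (\<chi> i j. a i j t)"

end

theory Submission
  imports Defs
begin

text \<open>
  Put \<open>E(t) = \<integral>\<^sub>0\<^sup>t e\<close>. The weighted maximum \<open>e\<^bsup>E(t)\<^esup> max\<^sub>i \<bar>x\<^sub>i(t)\<bar> / v\<^sub>i\<close> of a solution, once it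
  is bounded by \<open>K\<close> on \<open>[0, \<sigma>]\<close> for a large \<open>\<sigma>\<close>, stays bounded by \<open>K\<close> for ever. Suppose it is at most
  \<open>C\<close> up to time \<open>t\<close>. The normalization of \<open>\<nu>\<^sub>i\<^sub>j\<close> and \<open>g \<ge> 1\<close> bound the delayed term \<open>L\<^sub>i\<^sub>j(t)\<close> by
  \<open>a\<^sub>i\<^sub>j(t)\<close> times the maximum of \<open>\<bar>x\<^sub>j\<bar>\<close> on \<open>[t - \<tau>(t), t]\<close>, that is by
  \<open>a\<^sub>i\<^sub>j(t) e\<^bsup>E(t) - E(t - \<tau>(t))\<^esup> v\<^sub>j C e\<^bsup>-E(t)\<^esup>\<close>; the inequality \<open>\<tau>(t) \<le> t\<close> keeps the window inside
  \<open>[0, t]\<close>. Condition (i) therefore ensures that all terms of the \<open>i\<close>-th equation other than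
  \<open>-d\<^sub>i\<^sub>i x\<^sub>i\<close> add up to at most \<open>(d\<^sub>i\<^sub>i - e) v\<^sub>i C e\<^bsup>-E\<^esup>\<close> in absolute value, while \<open>y = v\<^sub>i C e\<^bsup>-E\<^esup>\<close>
  satisfies \<open>y' = -d\<^sub>i\<^sub>i y + (d\<^sub>i\<^sub>i - e) y\<close> almost everywhere. Variation of constants then shows that the bound
  by any \<open>C > K\<close> cannot be attained for the first time at any moment (\<open>weighted_bound\<close>,
  \<open>system_decay\<close>). Stability follows since \<open>K\<close> can be taken as a constant times the norm of the
  initial function, and attractivity since \<open>E(t) \<rightarrow> \<infinity>\<close> by (ii).

  Two points need work. First, \<open>\<bar>\<integral> \<psi> d\<nu>\<bar> \<le> \<integral> \<bar>\<psi>\<bar> d\<bar>\<nu>\<bar>\<close> has to be obtained from the distribution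
  functions of the Jordan decomposition (\<open>abs_stieltjes_integral_le\<close>). Secondly, \<open>e\<close> is merely
  locally integrable, so \<open>e\<^bsup>-E\<^esup>\<close> need not be differentiable everywhere; the only consequence of
  \<open>(e\<^bsup>F\<^esup>)' = F' e\<^bsup>F\<^esup>\<close> that enters is an integral inequality, which follows from the convexity of \<open>exp\<close>
  (\<open>integral_exp_primitive_le\<close>).
\<close>

section \<open>Stieltjes integrals of functions of bounded variation\<close>

lemma mono_right_limits:
  fixes F :: "real \<Rightarrow> real"
  assumes "mono F"
  obtains P where "\<And>s. (F \<longlongrightarrow> P s) (at_right s)" "\<And>s. continuous (at_right s) P"
proof
  define P where "P s = Inf (F ` {s<..})" for s
  have bdd: "bdd_below (F ` {s<..})" for s
    by (rule bdd_belowI[of _ "F s"]) (auto intro!: monoD[OF assms])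
  have lower: "P s \<le> F x" if "s < x" for s x
    unfolding P_def using that by (intro cInf_lower bdd) auto
  have mono: "P s \<le> P t" if "s \<le> t" for s t
    unfolding P_def[of t] using that by (intro cInf_greatest) (auto intro!: lower)
  have ex: "\<exists>x>s. F x < c" if "P s < c" for s c
    using that bdd[of s] unfolding P_def by (subst (asm) cInf_less_iff) auto
  show "(F \<longlongrightarrow> P s) (at_right s)" for s
  proof (rule order_tendstoI)
    fix c assume "c < P s"
    then show "\<forall>\<^sub>F x in at_right s. c < F x"
      unfolding eventually_at_filter
      by (intro always_eventually allI impI) (use lower[of s] in \<open>force intro: less_le_trans\<close>)
  next
    fix c assume "P s < c"
    then obtain x where "s < x" "F x < c" using ex by blast
    then show "\<forall>\<^sub>F x in at_right s. F x < c"
      unfolding eventually_at_right_field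
      by (intro exI[of _ x]) (meson assms less_imp_le le_less_trans monoD)
  qed
  show "continuous (at_right s) P" for s
    unfolding continuous_within
  proof (rule order_tendstoI)
    fix c assume "c < P s"
    then show "\<forall>\<^sub>F x in at_right s. c < P x"
      unfolding eventually_at_filter
      by (intro always_eventually allI impI) (use mono[of s] in \<open>force intro: less_le_trans\<close>)
  next
    fix c assume "P s < c"
    then obtain x where "s < x" "F x < c" using ex by blast
    then show "\<forall>\<^sub>F x in at_right s. P x < c"
      unfolding eventually_at_right_field
      by (intro exI[of _ x]) (meson lower le_less_trans)
  qed
qed

lemma zero_in_variation_sums: "x \<in> S \<Longrightarrow> 0 \<in> variation_sums f S"
  unfolding variation_sums_def by (auto intro!: exI[of _ "\<lambda>_. x"] exI[of _ 0])

lemma variation_sums_mono: "S \<subseteq> T \<Longrightarrow> variation_sums f S \<subseteq> variation_sums f T"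
  unfolding variation_sums_def by blast

text \<open>
  A chain of points in \<open>(-\<infinity>, s]\<close> can be prolonged by \<open>s\<close> and \<open>t\<close>. Consequently both \<open>V + f\<close> and
  \<open>V - f\<close> are nondecreasing, where \<open>V(s)\<close> is the variation of \<open>f\<close> on \<open>(-\<infinity>, s]\<close>.
\<close>

lemma total_variation_add_jump:
  assumes bv: "bounded_variation_on UNIV f" and "s \<le> t"
  shows "total_variation f {..s} + \<bar>f t - f s\<bar> \<le> total_variation f {..t}"
proof -
  have bdd: "bdd_above (variation_sums f {..t})"
    using bv variation_sums_mono[of "{..t}" UNIV f] unfolding bounded_variation_on_def
    by (auto intro: bdd_above_mono)
  have "x \<le> total_variation f {..t} - \<bar>f t - f s\<bar>" if "x \<in> variation_sums f {..s}" for x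
  proof -
    obtain u m where x: "x = (\<Sum>k<m. \<bar>f (u (Suc k)) - f (u k)\<bar>)"
      and u: "\<forall>k\<le>m. u k \<in> {..s}" "\<forall>k<m. u k \<le> u (Suc k)"
      using \<open>x \<in> _\<close> unfolding variation_sums_def by blast
    define w where "w k = (if k \<le> m then u k else if k = Suc m then s else t)" for k
    have "(\<Sum>k<Suc (Suc m). \<bar>f (w (Suc k)) - f (w k)\<bar>) \<in> variation_sums f {..t}"
      unfolding variation_sums_def
      using u \<open>s \<le> t\<close>
      by (intro CollectI exI[of _ w] exI[of _ "Suc (Suc m)"])
         (force simp: w_def less_Suc_eq le_Suc_eq)
    moreover have "(\<Sum>k<Suc (Suc m). \<bar>f (w (Suc k)) - f (w k)\<bar>) = x + \<bar>f s - f (u m)\<bar> + \<bar>f t - f s\<bar>"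
      unfolding x by (simp add: w_def)
    ultimately show ?thesis
      using cSup_upper[OF _ bdd] unfolding total_variation_def by fastforce
  qed
  then have "total_variation f {..s} \<le> total_variation f {..t} - \<bar>f t - f s\<bar>"
    unfolding total_variation_def[of _ "{..s}"]
    using zero_in_variation_sums[of s "{..s}" f] by (intro cSup_least) auto
  then show ?thesis by simp
qed

lemma bounded_variation_on_dominated:
  fixes P :: "real \<Rightarrow> real"
  assumes dom: "\<And>s t. s \<le> t \<Longrightarrow> \<bar>r t - r s\<bar> \<le> P t - P s"
    and bound: "\<And>s. \<bar>P s\<bar> \<le> M"
  shows "bounded_variation_on UNIV r"
  unfolding bounded_variation_on_def
proof (rule bdd_aboveI)
  fix x assume "x \<in> variation_sums r UNIV"
  then obtain u m where x: "x = (\<Sum>k<m. \<bar>r (u (Suc k)) - r (u k)\<bar>)"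
      and u: "\<forall>k<m. u k \<le> u (Suc k)"
    unfolding variation_sums_def by blast
  have "x \<le> (\<Sum>k<m. P (u (Suc k)) - P (u k))"
    unfolding x using u by (intro sum_mono dom) auto
  also have "\<dots> = P (u m) - P (u 0)" by (rule sum_lessThan_telescope)
  also have "\<dots> \<le> 2 * M" using bound[of "u m"] bound[of "u 0"] by linarith
  finally show "x \<le> 2 * M" .
qed

text \<open>
  Beyond \<open>s\<close>, a chain can pick up no more variation than the telescoping increments of \<open>P\<close>. Together
  with \<open>total_variation_add_jump\<close> this transfers right continuity from \<open>P\<close> to the variation of \<open>r\<close>.
\<close>

lemma total_variation_le_dominated:
  fixes P :: "real \<Rightarrow> real"
  assumes dom: "\<And>s t. s \<le> t \<Longrightarrow> \<bar>r t - r s\<bar> \<le> P t - P s"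
    and bv: "bounded_variation_on UNIV r" and "s \<le> t"
  shows "total_variation r {..t} \<le> total_variation r {..s} + (P t - P s)"
  unfolding total_variation_def[of _ "{..t}"]
proof (rule cSup_least)
  show "variation_sums r {..t} \<noteq> {}" using zero_in_variation_sums[of t "{..t}" r] by auto
next
  have bdd: "bdd_above (variation_sums r {..s})"
    using bv variation_sums_mono[of "{..s}" UNIV r] unfolding bounded_variation_on_def
    by (auto intro: bdd_above_mono)
  fix x assume "x \<in> variation_sums r {..t}"
  then obtain u m where x: "x = (\<Sum>k<m. \<bar>r (u (Suc k)) - r (u k)\<bar>)"
      and u: "\<forall>k\<le>m. u k \<le> t" "\<forall>k<m. u k \<le> u (Suc k)"
    unfolding variation_sums_def by auto
  \<comment> \<open>Cut the chain at \<open>s\<close>: \<open>lo\<close> and \<open>hi\<close> are its parts on either side, stopped at \<open>s\<close>.\<close>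
  define lo hi where "lo k = min (u k) s" and "hi k = max (u k) s" for k
  have "x \<le> (\<Sum>k<m. \<bar>r (lo (Suc k)) - r (lo k)\<bar> + \<bar>r (hi (Suc k)) - r (hi k)\<bar>)"
    unfolding x using u by (intro sum_mono) (force simp: lo_def hi_def min_def max_def)
  also have "\<dots> = (\<Sum>k<m. \<bar>r (lo (Suc k)) - r (lo k)\<bar>) + (\<Sum>k<m. \<bar>r (hi (Suc k)) - r (hi k)\<bar>)"
    by (rule sum.distrib)
  also have "(\<Sum>k<m. \<bar>r (lo (Suc k)) - r (lo k)\<bar>) \<le> total_variation r {..s}"
    unfolding total_variation_def
  proof (rule cSup_upper[OF _ bdd])
    have "\<forall>k\<le>m. lo k \<in> {..s}" "\<forall>k<m. lo k \<le> lo (Suc k)" using u by (force simp: lo_def)+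
    then show "(\<Sum>k<m. \<bar>r (lo (Suc k)) - r (lo k)\<bar>) \<in> variation_sums r {..s}"
      unfolding variation_sums_def by blast
  qed
  also have "(\<Sum>k<m. \<bar>r (hi (Suc k)) - r (hi k)\<bar>) \<le> (\<Sum>k<m. P (hi (Suc k)) - P (hi k))"
    using u by (intro sum_mono dom) (force simp: hi_def)
  also have "\<dots> = P (hi m) - P (hi 0)" by (rule sum_lessThan_telescope)
  also have "\<dots> \<le> P t - P s"
  proof -
    have "hi m \<le> t" "s \<le> hi 0" using u \<open>s \<le> t\<close> by (auto simp: hi_def)
    then have "\<bar>r t - r (hi m)\<bar> \<le> P t - P (hi m)" "\<bar>r (hi 0) - r s\<bar> \<le> P (hi 0) - P s"
      by (auto intro: dom)
    then show ?thesis by linarith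
  qed
  finally show "x \<le> total_variation r {..s} + (P t - P s)" by simp
qed

lemma right_continuous_dominated:
  fixes P :: "real \<Rightarrow> real"
  assumes dom: "\<And>t. s \<le> t \<Longrightarrow> \<bar>r t - r s\<bar> \<le> P t - P s"
    and "continuous (at_right s) P"
  shows "continuous (at_right s) r"
proof -
  have "((\<lambda>t. P t - P s) \<longlongrightarrow> 0) (at_right s)"
    using assms(2) unfolding continuous_within by (simp add: LIM_zero)
  then have "((\<lambda>t. r t - r s) \<longlongrightarrow> 0) (at_right s)"
    by (rule Lim_null_comparison[rotated]) (auto simp: eventually_at_filter intro!: always_eventually dom)
  then show ?thesis unfolding continuous_within by (simp add: LIM_zero_iff)
qed

text \<open>
  \<open>P\<close> is the right limit of the variation \<open>V\<close> of \<open>f\<close>, and \<open>f = V - (V - f)\<close> has right limits as a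
  difference of nondecreasing functions. The estimate is
  \<open>\<bar>f t' - f s'\<bar> \<le> V t' - V s'\<close> in the limit \<open>s' \<down> s\<close>, then \<open>t' \<down> t\<close>.
\<close>

lemma right_reg_dominated:
  assumes bv: "bounded_variation_on UNIV f"
  shows "\<exists>P M. (\<forall>s t. s \<le> t \<longrightarrow> \<bar>right_reg f t - right_reg f s\<bar> \<le> P t - P s) \<and>
    (\<forall>s. continuous (at_right s) P) \<and> (\<forall>s. \<bar>P s\<bar> \<le> (M::real))"
proof -
  let ?V = "\<lambda>s. total_variation f {..s}"
  note jump = total_variation_add_jump[OF bv]
  have "mono ?V" by (rule monoI) (use jump in force)
  then obtain P where P: "\<And>s. (?V \<longlongrightarrow> P s) (at_right s)" "\<And>s. continuous (at_right s) P"
    by (rule mono_right_limits) blast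
  have "mono (\<lambda>s. ?V s - f s)" by (rule monoI) (use jump in force)
  then obtain Q where Q: "\<And>s. ((\<lambda>s. ?V s - f s) \<longlongrightarrow> Q s) (at_right s)"
    by (rule mono_right_limits) blast
  have f: "(f \<longlongrightarrow> P s - Q s) (at_right s)" for s
    using tendsto_diff[OF P(1) Q, of s] by simp
  have rr: "(f \<longlongrightarrow> right_reg f s) (at_right s)" for s
    using f[of s] tendsto_Lim[OF _ f[of s]] unfolding right_reg_def by simp
  have dom: "\<bar>right_reg f t - right_reg f s\<bar> \<le> P t - P s" if "s \<le> t" for s t
  proof (cases "s = t")
    case False
    have near: "\<bar>f t' - right_reg f s\<bar> \<le> ?V t' - P s" if "s < t'" for t'
    proof (rule tendsto_le[of "at_right s"])
      show "((\<lambda>s'. ?V t' - ?V s') \<longlongrightarrow> ?V t' - P s) (at_right s)"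
        by (intro tendsto_intros P)
      show "((\<lambda>s'. \<bar>f t' - f s'\<bar>) \<longlongrightarrow> \<bar>f t' - right_reg f s\<bar>) (at_right s)"
        by (intro tendsto_intros rr)
      show "\<forall>\<^sub>F s' in at_right s. \<bar>f t' - f s'\<bar> \<le> ?V t' - ?V s'"
        unfolding eventually_at_right_field using that
        by (intro exI[of _ t']) (auto dest!: less_imp_le dest: jump)
    qed simp
    show ?thesis
    proof (rule tendsto_le[of "at_right t"])
      show "((\<lambda>t'. ?V t' - P s) \<longlongrightarrow> P t - P s) (at_right t)"
        by (intro tendsto_intros P)
      show "((\<lambda>t'. \<bar>f t' - right_reg f s\<bar>) \<longlongrightarrow> \<bar>right_reg f t - right_reg f s\<bar>) (at_right t)"
        by (intro tendsto_intros rr)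
      show "\<forall>\<^sub>F t' in at_right t. \<bar>f t' - right_reg f s\<bar> \<le> ?V t' - P s"
        using that by (auto simp: eventually_at_filter intro!: always_eventually near)
    qed simp
  qed simp
  have bdd: "bdd_above (variation_sums f UNIV)" using bv by (simp add: bounded_variation_on_def)
  have V: "0 \<le> ?V s" "?V s \<le> total_variation f UNIV" for s
  proof -
    have sub: "variation_sums f {..s} \<subseteq> variation_sums f UNIV" by (rule variation_sums_mono) simp
    show "0 \<le> ?V s" unfolding total_variation_def
      by (intro cSup_upper zero_in_variation_sums[of s] bdd_above_mono[OF bdd sub]) auto
    show "?V s \<le> total_variation f UNIV" unfolding total_variation_def
      using zero_in_variation_sums[of s "{..s}" f] by (intro cSup_subset_mono bdd sub) auto
  qed
  have "\<bar>P s\<bar> \<le> total_variation f UNIV" for s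
  proof -
    have "0 \<le> P s" by (rule tendsto_lowerbound[OF P(1)[of s]]) (use V in auto)
    moreover have "P s \<le> total_variation f UNIV"
      by (rule tendsto_upperbound[OF P(1)[of s]]) (use V in auto)
    ultimately show ?thesis by simp
  qed
  with dom P(2) show ?thesis by blast
qed

text \<open>
  These are the conditions under which \<^const>\<open>interval_measure\<close> has the intended values on half-open
  intervals, for the distribution functions of the positive and the negative variation.
\<close>

lemma jordan_decomposition:
  assumes bv: "bounded_variation_on UNIV f"
  defines "p \<equiv> \<lambda>s. (variation_fun f s + right_reg f s) / 2"
    and "n \<equiv> \<lambda>s. (variation_fun f s - right_reg f s) / 2"
  shows "mono p" "mono n" "\<And>s. continuous (at_right s) p" "\<And>s. continuous (at_right s) n"
proof -
  obtain P M where dom: "\<And>s t. s \<le> t \<Longrightarrow> \<bar>right_reg f t - right_reg f s\<bar> \<le> P t - P s"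
    and P: "\<And>s. continuous (at_right s) P" "\<And>s. \<bar>P s\<bar> \<le> (M::real)"
    using right_reg_dominated[OF bv] by blast
  have bvr: "bounded_variation_on UNIV (right_reg f)"
    by (rule bounded_variation_on_dominated[where P = P and M = M, OF dom P(2)])
  have jump: "variation_fun f s + \<bar>right_reg f t - right_reg f s\<bar> \<le> variation_fun f t"
    if "s \<le> t" for s t
    unfolding variation_fun_def by (rule total_variation_add_jump[OF bvr that])
  have le: "variation_fun f t \<le> variation_fun f s + (P t - P s)" if "s \<le> t" for s t
    unfolding variation_fun_def by (rule total_variation_le_dominated[where P = P, OF dom bvr that])
  have 1: "continuous (at_right s) (right_reg f)" for s
    by (rule right_continuous_dominated[where P = P, OF dom P(1)])
  have 2: "continuous (at_right s) (variation_fun f)" for s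
  proof (rule right_continuous_dominated[where P = P, OF _ P(1)])
    fix t assume "s \<le> t"
    then show "\<bar>variation_fun f t - variation_fun f s\<bar> \<le> P t - P s"
      using jump[of s t] le[of s t] by linarith
  qed
  show "mono p" "mono n"
  proof (rule_tac [!] monoI)
    fix s t :: real assume "s \<le> t"
    from jump[OF this] have "variation_fun f s + right_reg f s \<le> variation_fun f t + right_reg f t"
      "variation_fun f s - right_reg f s \<le> variation_fun f t - right_reg f t"
      by (simp_all add: abs_le_iff)
    then show "p s \<le> p t" "n s \<le> n t" unfolding p_def n_def by (simp_all add: divide_right_mono)
  qed
  show "continuous (at_right s) p" "continuous (at_right s) n" for s
    unfolding p_def n_def
    by (intro continuous_divide continuous_add continuous_diff continuous_const 1 2; simp)+
qed

text \<open>
  The two sides agree on the half-open intervals, which generate the Borel sets and have finite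
  measure.
\<close>

lemma emeasure_interval_measure_add:
  fixes F G :: "real \<Rightarrow> real"
  assumes "mono F" "mono G" "\<And>s. continuous (at_right s) F" "\<And>s. continuous (at_right s) G"
    and A: "A \<in> sets borel"
  shows "emeasure (interval_measure (\<lambda>s. F s + G s)) A =
    emeasure (interval_measure F) A + emeasure (interval_measure G) A"
proof -
  let ?F = "interval_measure F" and ?G = "interval_measure G"
  let ?H = "interval_measure (\<lambda>s. F s + G s)"
  define N where "N = measure_of (UNIV::real set) (sets borel) (\<lambda>A. emeasure ?F A + emeasure ?G A)"
  have setsN: "sets N = sets borel" unfolding N_def using sets.sigma_sets_eq[of borel] by simp
  have N: "emeasure N B = emeasure ?F B + emeasure ?G B" if "B \<in> sets borel" for B
  proof (rule emeasure_measure_of[OF N_def])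
    show "countably_additive (sets N) (\<lambda>A. emeasure ?F A + emeasure ?G A)"
      unfolding countably_additive_def setsN
      by (auto simp: suminf_add[symmetric] suminf_emeasure)
  qed (use that in \<open>auto simp: positive_def setsN\<close>)
  have Ioc: "emeasure ?H {a<..b} = emeasure N {a<..b} \<and> emeasure N {a<..b} \<noteq> \<infinity>" for a b
  proof (cases "a \<le> b")
    case True
    have H: "emeasure ?H {a<..b} = ennreal (F b + G b - (F a + G a))"
      using assms True
      by (intro emeasure_interval_measure_Ioc) (auto intro!: continuous_intros add_mono dest: monoD)
    note H also have "\<dots> = ennreal (F b - F a) + ennreal (G b - G a)"
      using assms(1,2) True by (subst ennreal_plus[symmetric]) (auto dest: monoD simp: algebra_simps)
    also have "\<dots> = emeasure N {a<..b}"
      using assms True by (subst N) (auto simp: emeasure_interval_measure_Ioc monoD)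
    finally show ?thesis using H by (metis ennreal_neq_top infinity_ennreal_def)
  qed simp
  have "?H = N"
  proof (rule measure_eqI_generator_eq[where \<Omega> = UNIV and E = "range (\<lambda>(a, b). {a<..b::real})"])
    show "(\<Union>i. {- real (i::nat)<..real i}) = UNIV"
    proof (intro set_eqI iffI UNIV_I)
      fix x :: real
      obtain i where "\<bar>x\<bar> < real i" using reals_Archimedean2 by blast
      then have "x \<in> {- real i<..real i}" by auto
      then show "x \<in> (\<Union>i. {- real (i::nat)<..real i})" by blast
    qed
    show "Int_stable (range (\<lambda>(a, b). {a<..b::real}))"
      by (auto simp: Int_stable_def)
  qed (use Ioc in \<open>auto simp: setsN borel_sigma_sets_Ioc\<close>)
  with N[OF A] show ?thesis by simp
qed

lemma nn_integral_measure_add: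
  assumes "sets M = sets H" "sets N = sets H"
    and add: "\<And>A. A \<in> sets H \<Longrightarrow> emeasure H A = emeasure M A + emeasure N A"
    and "h \<in> borel_measurable H"
  shows "(\<integral>\<^sup>+s. h s \<partial>H) = (\<integral>\<^sup>+s. h s \<partial>M) + (\<integral>\<^sup>+s. h s \<partial>N)"
  using \<open>h \<in> borel_measurable H\<close>
proof (induction rule: borel_measurable_induct)
  case (cong f g)
  have "space H = space M" "space H = space N" using assms(1,2) by (auto dest: sets_eq_imp_space_eq)
  with cong show ?case by (auto cong: nn_integral_cong_simp)
next
  case (set A)
  then show ?case using assms(1,2) add by simp
next
  case (mult u c)
  moreover have "u \<in> borel_measurable M" "u \<in> borel_measurable N"
    using mult assms(1,2) by (simp_all cong: measurable_cong_sets)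
  ultimately show ?case by (simp add: nn_integral_cmult distrib_left)
next
  case (add u v)
  moreover have "u \<in> borel_measurable M" "u \<in> borel_measurable N"
     "v \<in> borel_measurable M" "v \<in> borel_measurable N"
    using add assms(1,2) by (simp_all cong: measurable_cong_sets)
  ultimately show ?case by (simp add: nn_integral_add ac_simps)
next
  case (seq U)
  have m: "U i \<in> borel_measurable M" "U i \<in> borel_measurable N" for i
    using seq assms(1,2) by (simp_all cong: measurable_cong_sets)
  have inc: "incseq (\<lambda>i. \<integral>\<^sup>+s. U i s \<partial>K)" for K :: "'a measure"
    using seq by (auto intro!: incseq_SucI nn_integral_mono simp: incseq_def le_fun_def)
  have "(\<integral>\<^sup>+s. (SUP i. U i) s \<partial>K) = (SUP i. \<integral>\<^sup>+s. U i s \<partial>K)" 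
    if "\<And>i. U i \<in> borel_measurable K" for K :: "'a measure"
    using nn_integral_monotone_convergence_SUP[OF \<open>incseq U\<close> that] by (simp add: image_comp)
  then show ?case using seq m
    by (simp add: ennreal_SUP_add inc)
qed

text \<open>
  Should \<open>\<psi>\<close> fail to be integrable, its Bochner integral is 0 and the bound is trivial.
\<close>

lemma abs_set_lebesgue_integral_le:
  fixes \<psi> w :: "real \<Rightarrow> real"
  assumes "set_integrable M S w" and "\<And>s. s \<in> S \<Longrightarrow> \<bar>\<psi> s\<bar> \<le> w s"
  shows "\<bar>LINT s:S|M. \<psi> s\<bar> \<le> (LINT s:S|M. w s)"
proof (cases "set_integrable M S \<psi>")
  case True
  then show ?thesis unfolding set_lebesgue_integral_def
    using assms unfolding set_integrable_def
    by (intro integral_abs_bound_integral) (auto simp: indicator_def)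
next
  case False
  then have "(LINT s:S|M. \<psi> s) = 0"
    unfolding set_integrable_def set_lebesgue_integral_def by (rule not_integrable_integral_eq)
  moreover have "0 \<le> (LINT s:S|M. w s)"
    unfolding set_lebesgue_integral_def using assms(2)
    by (intro Bochner_Integration.integral_nonneg) (force simp: indicator_def)
  ultimately show ?thesis by simp
qed

text \<open>
  The positive and negative variation add up to the total variation because their distribution
  functions \<open>(V + f\<^sup>+) / 2\<close> and \<open>(V - f\<^sup>+) / 2\<close> do.
\<close>

lemma abs_stieltjes_integral_le:
  fixes w \<psi> :: "real \<Rightarrow> real"
  assumes bv: "bounded_variation_on UNIV f"
    and w: "set_integrable (variation_measure f) S w"
    and le: "\<And>s. s \<in> S \<Longrightarrow> \<bar>\<psi> s\<bar> \<le> w s"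
  shows "\<bar>stieltjes_integral f S \<psi>\<bar> \<le> (LINT s:S|variation_measure f. w s)"
proof -
  let ?p = "pos_variation_measure f" and ?n = "neg_variation_measure f"
  let ?v = "variation_measure f"
  have sets: "sets ?p = sets borel" "sets ?n = sets borel" "sets ?v = sets borel"
    by (simp_all add: pos_variation_measure_def neg_variation_measure_def variation_measure_def)
  have split: "variation_fun f = (\<lambda>s. (variation_fun f s + right_reg f s) / 2 
      + (variation_fun f s - right_reg f s) / 2)"
    by (auto simp: field_simps)
  have em: "emeasure ?v A = emeasure ?p A + emeasure ?n A" if "A \<in> sets ?v" for A
    unfolding variation_measure_def pos_variation_measure_def neg_variation_measure_def
    by (subst split, rule emeasure_interval_measure_add)
       (use that jordan_decomposition[OF bv] sets in auto)
  define h where "h s = indicator S s * w s" for s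
  have h0: "0 \<le> h s" for s using le[of s] by (auto simp: h_def indicator_def)
  have int: "integrable ?v h" using w by (simp add: set_integrable_def h_def[abs_def])
  then have hm: "h \<in> borel_measurable ?v" "h \<in> borel_measurable ?p" "h \<in> borel_measurable ?n"
    using sets by (simp_all cong: measurable_cong_sets add: borel_measurable_integrable)
  have nn: "(\<integral>\<^sup>+s. ennreal (h s) \<partial>?v) = (\<integral>\<^sup>+s. ennreal (h s) \<partial>?p) + (\<integral>\<^sup>+s. ennreal (h s) \<partial>?n)"
    using sets em hm by (intro nn_integral_measure_add) auto
  have fin: "(\<integral>\<^sup>+s. ennreal (h s) \<partial>?v) < \<infinity>"
    using int h0 by (simp add: integrable_iff_bounded)
  have intp: "integrable ?p h" and intn: "integrable ?n h"
    using fin hm h0 unfolding nn by (auto simp: integrable_iff_bounded)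
  have "ennreal (\<integral>s. h s \<partial>?v) = ennreal ((\<integral>s. h s \<partial>?p) + (\<integral>s. h s \<partial>?n))"
    using nn int intp intn h0 by (simp add: nn_integral_eq_integral)
  then have "(\<integral>s. h s \<partial>?v) = (\<integral>s. h s \<partial>?p) + (\<integral>s. h s \<partial>?n)"
    using h0 by (subst (asm) ennreal_inj) auto
  then have eq: "(LINT s:S|?v. w s) = (LINT s:S|?p. w s) + (LINT s:S|?n. w s)"
    by (simp add: set_lebesgue_integral_def h_def[abs_def, symmetric])
  have "set_integrable ?p S w" "set_integrable ?n S w"
    using intp intn by (simp_all add: set_integrable_def h_def[abs_def])
  then have "\<bar>LINT s:S|?p. \<psi> s\<bar> \<le> (LINT s:S|?p. w s)" "\<bar>LINT s:S|?n. \<psi> s\<bar> \<le> (LINT s:S|?n. w s)"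
    using le by (auto intro: abs_set_lebesgue_integral_le)
  then show ?thesis unfolding stieltjes_integral_def eq by linarith
qed

section \<open>A comparison principle with locally integrable rates\<close>

text \<open>
  By convexity of \<open>exp\<close>, \<open>e\<^bsup>F(x)\<^esup> (F(y) - F(x)) \<le> e\<^bsup>F(y)\<^esup> - e\<^bsup>F(x)\<^esup>\<close>. The left-hand side is
  \<open>\<integral>\<^sub>x\<^sup>y f(t) e\<^bsup>F(x)\<^esup> dt\<close>, which differs from \<open>\<integral>\<^sub>x\<^sup>y f e\<^bsup>F\<^esup>\<close> by at most \<open>\<eta> \<integral>\<^sub>x\<^sup>y \<bar>f\<bar>\<close> on short intervals, as
  \<open>e\<^bsup>F\<^esup>\<close> is uniformly continuous. Both sides of the resulting inequality are additive over adjacent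
  intervals, so it extends to \<open>[a, b]\<close>; finally \<open>\<eta> \<rightarrow> 0\<close>.
\<close>

lemma integral_exp_primitive_le:
  fixes f F :: "real \<Rightarrow> real"
  assumes "a \<le> b" and contF: "continuous_on {a..b} F"
    and f: "f absolutely_integrable_on {a..b}"
    and F: "\<And>x y. a \<le> x \<Longrightarrow> x \<le> y \<Longrightarrow> y \<le> b \<Longrightarrow> (f has_integral F y - F x) {x..y}"
  shows "(\<lambda>t. f t * exp (F t)) integrable_on {a..b}"
    and "integral {a..b} (\<lambda>t. f t * exp (F t)) \<le> exp (F b) - exp (F a)"
proof -
  let ?h = "\<lambda>t. f t * exp (F t)"
  have contE: "continuous_on {a..b} (\<lambda>t. exp (F t))" by (intro continuous_intros contF)
  have "(\<lambda>t. exp (F t) * f t) absolutely_integrable_on {a..b}"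
    by (intro absolutely_integrable_bounded_measurable_product_real f
        continuous_imp_measurable_on_sets_lebesgue contE compact_imp_bounded
        compact_continuous_image compact_Icc) auto
  then show int: "?h integrable_on {a..b}"
    by (simp add: mult.commute set_lebesgue_integral_eq_integral(1))
  have fint: "f integrable_on {a..b}" and absint: "(\<lambda>t. \<bar>f t\<bar>) integrable_on {a..b}"
    using f by (auto simp: absolutely_integrable_on_def)
  have ucont: "uniformly_continuous_on {a..b} (\<lambda>t. exp (F t))"
    using contE by (rule compact_uniformly_continuous) simp
  have approx: "integral {a..b} ?h \<le> exp (F b) - exp (F a) + \<eta> * integral {a..b} (\<lambda>t. \<bar>f t\<bar>)"
    if "\<eta> > 0" for \<eta>
  proof -
    obtain \<delta> where "\<delta> > 0"
      and \<delta>: "\<And>x y. x \<in> {a..b} \<Longrightarrow> y \<in> {a..b} \<Longrightarrow> dist y x < \<delta> \<Longrightarrow> dist (exp (F y)) (exp (F x)) < \<eta>"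
      using ucont \<open>\<eta> > 0\<close> unfolding uniformly_continuous_on_def by blast
    define Q where "Q x y \<longleftrightarrow> (a \<le> x \<longrightarrow> y \<le> b \<longrightarrow>
      integral {x..y} ?h \<le> exp (F y) - exp (F x) + \<eta> * integral {x..y} (\<lambda>t. \<bar>f t\<bar>))" for x y
    have "Q a b" using \<open>a \<le> b\<close>
    proof (induct rule: Bolzano)
      case (trans x y z)
      show ?case unfolding Q_def
      proof (intro impI)
        assume "a \<le> x" "z \<le> b"
        then have sub: "{x..z} \<subseteq> {a..b}" by auto
        have "integral {x..z} ?h = integral {x..y} ?h + integral {y..z} ?h"
          using trans by (intro Henstock_Kurzweil_Integration.integral_combine[symmetric]
            integrable_on_subinterval[OF int sub]) auto
        moreover have "integral {x..z} (\<lambda>t. \<bar>f t\<bar>) = integral {x..y} (\<lambda>t. \<bar>f t\<bar>) + integral {y..z} (\<lambda>t. \<bar>f t\<bar>)"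
          using trans by (intro Henstock_Kurzweil_Integration.integral_combine[symmetric]
            integrable_on_subinterval[OF absint sub]) auto
        ultimately show "integral {x..z} ?h \<le> exp (F z) - exp (F x) + \<eta> * integral {x..z} (\<lambda>t. \<bar>f t\<bar>)"
          using trans \<open>a \<le> x\<close> \<open>z \<le> b\<close> by (simp add: Q_def distrib_left)
      qed
    next
      case (local c)
      have "Q x y" if "x \<le> c" "c \<le> y" "y - x < \<delta>" for x y
        unfolding Q_def
      proof (intro impI)
        assume "a \<le> x" "y \<le> b"
        then have sub: "{x..y} \<subseteq> {a..b}" and xy: "x \<le> y" using that by auto
        note ints = integrable_on_subinterval[OF int sub] integrable_on_subinterval[OF fint sub]
          integrable_on_subinterval[OF absint sub]
        have "integral {x..y} ?h \<le> integral {x..y} (\<lambda>t. exp (F x) * f t + \<eta> * \<bar>f t\<bar>)"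
        proof (rule integral_le)
          fix t assume t: "t \<in> {x..y}"
          then have "dist (exp (F t)) (exp (F x)) < \<eta>"
            using \<open>a \<le> x\<close> \<open>y \<le> b\<close> that by (intro \<delta>) (auto simp: dist_real_def)
          then have "\<bar>exp (F t) - exp (F x)\<bar> * \<bar>f t\<bar> \<le> \<eta> * \<bar>f t\<bar>"
            by (intro mult_right_mono) (auto simp: dist_real_def)
          moreover have "(exp (F t) - exp (F x)) * f t \<le> \<bar>exp (F t) - exp (F x)\<bar> * \<bar>f t\<bar>"
            by (metis abs_ge_self abs_mult)
          ultimately show "?h t \<le> exp (F x) * f t + \<eta> * \<bar>f t\<bar>"
            by (simp add: algebra_simps)
        qed (use ints in \<open>auto intro!: integrable_add integrable_on_mult_right\<close>)
        also have "\<dots> = exp (F x) * integral {x..y} f + \<eta> * integral {x..y} (\<lambda>t. \<bar>f t\<bar>)"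
          using ints by (subst Henstock_Kurzweil_Integration.integral_add) (auto intro!: integrable_on_mult_right)
        also have "integral {x..y} f = F y - F x"
          using F \<open>a \<le> x\<close> xy \<open>y \<le> b\<close> by (intro integral_unique) auto
        also have "exp (F x) * (F y - F x) \<le> exp (F x) * (exp (F y - F x) - 1)"
          using exp_ge_add_one_self[of "F y - F x"] by (intro mult_left_mono) (linarith, simp)
        also have "\<dots> = exp (F y) - exp (F x)" by (simp add: exp_diff algebra_simps)
        finally show "integral {x..y} ?h \<le> exp (F y) - exp (F x) + \<eta> * integral {x..y} (\<lambda>t. \<bar>f t\<bar>)"
          by simp
      qed
      with \<open>\<delta> > 0\<close> show ?case by blast
    qed
    then show ?thesis by (simp add: Q_def)
  qed
  have "((\<lambda>\<eta>. exp (F b) - exp (F a) + \<eta> * integral {a..b} (\<lambda>t. \<bar>f t\<bar>)) \<longlongrightarrow>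
      exp (F b) - exp (F a) + 0 * integral {a..b} (\<lambda>t. \<bar>f t\<bar>)) (at_right 0)"
    by (intro tendsto_intros)
  then have "integral {a..b} ?h \<le> exp (F b) - exp (F a) + 0 * integral {a..b} (\<lambda>t. \<bar>f t\<bar>)"
    by (rule tendsto_lowerbound) (auto simp: eventually_at_filter approx)
  then show "integral {a..b} ?h \<le> exp (F b) - exp (F a)" by simp
qed

text \<open>
  Variation of constants: with \<open>B' = d\<close>, the derivative of \<open>X e\<^bsup>B\<^esup>\<close> is \<open>R e\<^bsup>B\<^esup>\<close>, which is bounded by
  \<open>C (d - e) e\<^bsup>B - E\<^esup>\<close>. Up to the factor \<open>C\<close>, the integral of the latter is at most the increment of
  \<open>e\<^bsup>B - E\<^esup>\<close>, so the strict inequality at \<open>\<sigma>\<close> persists at \<open>t\<close>.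
\<close>

lemma strict_weighted_bound:
  fixes X R d e E :: "real \<Rightarrow> real"
  assumes "\<sigma> \<le> t" "0 < C"
    and deriv: "\<And>s. s \<in> {\<sigma>..t} \<Longrightarrow>
      (X has_real_derivative R s - d s * X s) (at s within {\<sigma>..t})"
    and d: "continuous_on {\<sigma>..t} d"
    and e: "e absolutely_integrable_on {\<sigma>..t}" and contE: "continuous_on {\<sigma>..t} E"
    and E: "\<And>x y. \<sigma> \<le> x \<Longrightarrow> x \<le> y \<Longrightarrow> y \<le> t \<Longrightarrow> (e has_integral E y - E x) {x..y}"
    and R: "\<And>s. s \<in> {\<sigma>..t} \<Longrightarrow> \<bar>R s\<bar> \<le> (d s - e s) * (C * exp (- E s))"
    and init: "\<bar>X \<sigma>\<bar> < C * exp (- E \<sigma>)"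
  shows "\<bar>X t\<bar> < C * exp (- E t)"
proof -
  define B where "B s = integral {\<sigma>..s} d" for s
  define F where "F s = B s - E s" for s
  let ?f = "\<lambda>s. d s - e s"
  have B': "(B has_real_derivative d s) (at s within {\<sigma>..t})" if "s \<in> {\<sigma>..t}" for s
    unfolding B_def using integral_has_real_derivative[OF d that] by simp
  have dint: "d integrable_on {\<sigma>..t}" using d by (rule integrable_continuous_real)
  have B: "(d has_integral B y - B x) {x..y}" if "\<sigma> \<le> x" "x \<le> y" "y \<le> t" for x y
  proof -
    have "B x + integral {x..y} d = B y"
      unfolding B_def using that
      by (intro Henstock_Kurzweil_Integration.integral_combine integrable_on_subinterval[OF dint]) auto
    moreover have "(d has_integral integral {x..y} d) {x..y}"
      using that by (intro integrable_integral integrable_on_subinterval[OF dint]) auto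
    ultimately show ?thesis by (metis add_diff_cancel_left')
  qed
  have contF: "continuous_on {\<sigma>..t} F"
    unfolding F_def by (intro continuous_intros contE DERIV_continuous_on[OF B'])
  have "?f absolutely_integrable_on {\<sigma>..t}"
    by (intro set_integral_diff(1) e absolutely_integrable_continuous_real d)
  moreover have "(?f has_integral F y - F x) {x..y}" if "\<sigma> \<le> x" "x \<le> y" "y \<le> t" for x y
    using has_integral_diff[OF B[OF that] E[OF that]] by (simp add: F_def algebra_simps)
  ultimately have int: "(\<lambda>s. ?f s * exp (F s)) integrable_on {\<sigma>..t}"
    and le: "integral {\<sigma>..t} (\<lambda>s. ?f s * exp (F s)) \<le> exp (F t) - exp (F \<sigma>)"
    using integral_exp_primitive_le[OF \<open>\<sigma> \<le> t\<close> contF] by blast+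
  have "((\<lambda>s. R s * exp (B s)) has_integral X t * exp (B t) - X \<sigma> * exp (B \<sigma>)) {\<sigma>..t}"
  proof (rule fundamental_theorem_of_calculus[OF \<open>\<sigma> \<le> t\<close>])
    fix s assume s: "s \<in> {\<sigma>..t}"
    have "((\<lambda>s. X s * exp (B s)) has_real_derivative R s * exp (B s)) (at s within {\<sigma>..t})"
      by (rule derivative_eq_intros deriv[OF s] B'[OF s] refl)+ (simp add: algebra_simps)
    then show "((\<lambda>s. X s * exp (B s)) has_vector_derivative R s * exp (B s)) (at s within {\<sigma>..t})"
      by (simp add: has_real_derivative_iff_has_vector_derivative)
  qed
  then have Req: "integral {\<sigma>..t} (\<lambda>s. R s * exp (B s)) = X t * exp (B t) - X \<sigma> * exp (B \<sigma>)"
    and Rint: "(\<lambda>s. R s * exp (B s)) integrable_on {\<sigma>..t}"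
    by (auto simp: integral_unique has_integral_integrable)
  have "\<bar>X t * exp (B t) - X \<sigma> * exp (B \<sigma>)\<bar> = norm (integral {\<sigma>..t} (\<lambda>s. R s * exp (B s)))"
    by (simp add: Req)
  also have "\<dots> \<le> integral {\<sigma>..t} (\<lambda>s. C * (?f s * exp (F s)))"
  proof (rule integral_norm_bound_integral[OF Rint])
    fix s assume "s \<in> {\<sigma>..t}"
    from mult_right_mono[OF R[OF this], of "exp (B s)"]
    show "norm (R s * exp (B s)) \<le> C * (?f s * exp (F s))"
      by (simp add: abs_mult F_def exp_diff exp_minus field_simps)
  qed (use int in \<open>auto intro: integrable_on_mult_right\<close>)
  also have "\<dots> = C * integral {\<sigma>..t} (\<lambda>s. ?f s * exp (F s))" by simp
  also have "\<dots> \<le> C * (exp (F t) - exp (F \<sigma>))" using le \<open>0 < C\<close> by simp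
  finally have "\<bar>X t * exp (B t)\<bar> \<le> \<bar>X \<sigma> * exp (B \<sigma>)\<bar> + C * (exp (F t) - exp (F \<sigma>))"
    by linarith
  also have "\<bar>X \<sigma> * exp (B \<sigma>)\<bar> < C * exp (- E \<sigma>) * exp (B \<sigma>)"
    using init by (simp add: abs_mult)
  also have "C * exp (- E \<sigma>) * exp (B \<sigma>) = C * exp (F \<sigma>)"
    by (simp add: F_def exp_diff exp_minus field_simps)
  finally have "\<bar>X t\<bar> * exp (B t) < C * exp (F t)" by (simp add: abs_mult right_diff_distrib)
  then show ?thesis by (simp add: F_def exp_diff exp_minus field_simps)
qed

text \<open>
  The estimate on \<open>R\<close> is required only as long as the bound to be proved, with some constant \<open>C\<close> in
  place of \<open>K\<close>, has held in the past. For \<open>C > K\<close> let \<open>t\<^sub>1\<close> be the first time at which the bound by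
  \<open>C\<close> is attained by some component. Up to \<open>t\<^sub>1\<close> the estimate is available, and
  \<open>strict_weighted_bound\<close> yields a strict inequality at \<open>t\<^sub>1\<close>, a contradiction. Then let \<open>C \<down> K\<close>.
\<close>

lemma weighted_bound:
  fixes X R d :: "'i::finite \<Rightarrow> real \<Rightarrow> real" and e E :: "real \<Rightarrow> real" and v :: "'i \<Rightarrow> real"
  assumes "0 \<le> \<sigma>" and v: "\<And>i. 0 < v i"
    and contX: "\<And>i. continuous_on {0..} (X i)"
    and deriv: "\<And>i t. \<sigma> \<le> t \<Longrightarrow>
      (X i has_real_derivative R i t - d i t * X i t) (at t within {\<sigma>..})"
    and d: "\<And>i. continuous_on {\<sigma>..} (d i)"
    and e: "\<And>b. e absolutely_integrable_on {\<sigma>..b}" and contE: "continuous_on {0..} E"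
    and E: "\<And>x y. \<sigma> \<le> x \<Longrightarrow> x \<le> y \<Longrightarrow> (e has_integral E y - E x) {x..y}"
    and R: "\<And>i t C. \<sigma> \<le> t \<Longrightarrow> 0 \<le> C \<Longrightarrow>
      (\<And>j s. 0 \<le> s \<Longrightarrow> s \<le> t \<Longrightarrow> \<bar>X j s\<bar> \<le> v j * C * exp (- E s)) \<Longrightarrow>
      \<bar>R i t\<bar> \<le> (d i t - e t) * (v i * C * exp (- E t))"
    and "0 \<le> K"
    and init: "\<And>j s. 0 \<le> s \<Longrightarrow> s \<le> \<sigma> \<Longrightarrow> \<bar>X j s\<bar> \<le> v j * K * exp (- E s)"
    and "\<sigma> \<le> t"
  shows "\<bar>X i t\<bar> \<le> v i * K * exp (- E t)"
proof -
  have strict: "\<bar>X i t\<bar> < v i * C * exp (- E t)" if "K < C" "\<sigma> \<le> t" for C i t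
  proof (rule ccontr)
    have "0 < C" using \<open>0 \<le> K\<close> that by simp
    define S where "S = (\<Union>i. {t \<in> {\<sigma>..}. v i * C * exp (- E t) \<le> \<bar>X i t\<bar>})"
    assume "\<not> \<bar>X i t\<bar> < v i * C * exp (- E t)"
    with \<open>\<sigma> \<le> t\<close> have "S \<noteq> {}" by (auto simp: S_def not_less)
    have sub: "{\<sigma>..} \<subseteq> {0..}" using \<open>0 \<le> \<sigma>\<close> by auto
    have "closed {t \<in> {\<sigma>..}. v i * C * exp (- E t) \<le> \<bar>X i t\<bar>}" for i
      by (intro continuous_on_closed_Collect_le continuous_intros closed_atLeast
          continuous_on_subset[OF contX sub] continuous_on_subset[OF contE sub])
    then have "closed S" unfolding S_def by (intro closed_UN) auto
    have bdd: "bdd_below S" by (rule bdd_belowI[of _ \<sigma>]) (auto simp: S_def)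
    define t1 where "t1 = Inf S"
    have "t1 \<in> S" unfolding t1_def using \<open>S \<noteq> {}\<close> bdd \<open>closed S\<close> by (rule closed_contains_Inf)
    then obtain k where k: "\<sigma> \<le> t1" "v k * C * exp (- E t1) \<le> \<bar>X k t1\<bar>" by (auto simp: S_def)
    have init_lt: "\<bar>X j s\<bar> < v j * C * exp (- E s)" if "0 \<le> s" "s \<le> \<sigma>" for j s
    proof -
      have "v j * K * exp (- E s) < v j * C * exp (- E s)" using \<open>K < C\<close> v[of j] by simp
      with init[OF that] show ?thesis by (rule le_less_trans)
    qed
    have before: "\<bar>X j s\<bar> < v j * C * exp (- E s)" if "0 \<le> s" "s < t1" for j s
    proof (cases "s \<le> \<sigma>")
      case False
      with that have "s \<notin> S" using cInf_lower[OF _ bdd, of s] unfolding t1_def by auto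
      with False show ?thesis by (auto simp: S_def not_le)
    qed (use that init_lt in auto)
    have "t1 \<noteq> \<sigma>" using init_lt[of \<sigma> k] k \<open>0 \<le> \<sigma>\<close> by auto
    with k have "\<sigma> < t1" by simp
    have upto: "\<bar>X j s\<bar> \<le> v j * C * exp (- E s)" if "0 \<le> s" "s \<le> t1" for j s
    proof -
      have c: "closure {0..<t1} = {0..t1}" using \<open>0 \<le> \<sigma>\<close> \<open>\<sigma> < t1\<close> by simp
      have "0 \<le> v j * C * exp (- E s) - \<bar>X j s\<bar>"
      proof (rule continuous_ge_on_closure[where S = "{0..<t1}" and
          f = "\<lambda>s. v j * C * exp (- E s) - \<bar>X j s\<bar>"])
        show "continuous_on (closure {0..<t1}) (\<lambda>s. v j * C * exp (- E s) - \<bar>X j s\<bar>)"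
          unfolding c by (intro continuous_intros continuous_on_subset[OF contX] continuous_on_subset[OF contE]) auto
      qed (use that c before in \<open>auto simp: less_imp_le\<close>)
      then show ?thesis by simp
    qed
    have "\<bar>X k t1\<bar> < (v k * C) * exp (- E t1)"
    proof (rule strict_weighted_bound[OF \<open>\<sigma> \<le> t1\<close>])
      show "(X k has_real_derivative R k s - d k s * X k s) (at s within {\<sigma>..t1})"
        if "s \<in> {\<sigma>..t1}" for s
        using that by (intro has_field_derivative_subset[OF deriv]) auto
      show "\<bar>R k s\<bar> \<le> (d k s - e s) * (v k * C * exp (- E s))" if "s \<in> {\<sigma>..t1}" for s
        using that \<open>0 < C\<close> by (intro R) (auto intro!: upto)
      show "\<bar>X k \<sigma>\<bar> < v k * C * exp (- E \<sigma>)" using \<open>0 \<le> \<sigma>\<close> by (intro init_lt) auto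
      show "continuous_on {\<sigma>..t1} (d k)" by (rule continuous_on_subset[OF d]) auto
      show "continuous_on {\<sigma>..t1} E" using \<open>0 \<le> \<sigma>\<close> by (intro continuous_on_subset[OF contE]) auto
    qed (use v[of k] \<open>0 < C\<close> e E in auto)
    with k show False by simp
  qed
  have "((\<lambda>C. v i * C * exp (- E t)) \<longlongrightarrow> v i * K * exp (- E t)) (at_right K)"
    by (intro tendsto_intros)
  then show ?thesis
    by (rule tendsto_lowerbound)
       (use strict[OF _ \<open>\<sigma> \<le> t\<close>] in \<open>auto simp: eventually_at_filter intro!: always_eventually less_imp_le\<close>)
qed

section \<open>Phase space, solutions and the integral of the rate\<close>

text \<open>
  Since \<open>g \<ge> 1\<close>, the constant \<open>C\<close> is below \<open>C g\<close>, whose integral against the total variation is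
  \<open>C\<close> by the normalization.
\<close>

lemma abs_delay_op_le:
  assumes g: "phase_weight g" and bv: "bounded_variation_on UNIV (\<nu> t)"
    and norm: "(LINT s:{- \<tau> t..0}|variation_measure (\<nu> t). g s) = 1"
    and "0 \<le> a t" and "0 \<le> C"
    and le: "\<And>s. s \<in> {- \<tau> t..0} \<Longrightarrow> \<bar>\<psi> s\<bar> \<le> C"
  shows "\<bar>delay_op a \<tau> \<nu> t \<psi>\<bar> \<le> a t * C"
proof -
  let ?S = "{- \<tau> t..0}" and ?M = "variation_measure (\<nu> t)"
  \<comment> \<open>A divergent integral would be 0 by default, not 1.\<close>
  have "set_integrable ?M ?S g"
  proof (rule ccontr)
    assume "\<not> set_integrable ?M ?S g"
    then have "(LINT s:?S|?M. g s) = 0"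
      unfolding set_integrable_def set_lebesgue_integral_def by (rule not_integrable_integral_eq)
    with norm show False by simp
  qed
  moreover have "\<bar>\<psi> s\<bar> \<le> C * g s" if "s \<in> ?S" for s
  proof -
    have "1 \<le> g s" using g that by (auto simp: phase_weight_def)
    then have "C * 1 \<le> C * g s" using \<open>0 \<le> C\<close> by (intro mult_left_mono) auto
    with le[OF that] show ?thesis by simp
  qed
  ultimately have "\<bar>stieltjes_integral (\<nu> t) ?S \<psi>\<bar> \<le> (LINT s:?S|?M. C * g s)"
    using bv by (intro abs_stieltjes_integral_le set_integrable_mult_right) auto
  also have "\<dots> = C" using norm by simp
  finally show ?thesis
    unfolding delay_op_def using \<open>0 \<le> a t\<close> by (simp add: abs_mult mult_left_mono)
qed

text \<open>
  The supremum defining \<^const>\<open>gnorm\<close> is a genuine one: the quotient is less than 1 near \<open>-\<infinity>\<close> and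
  continuous on the remaining compact interval.
\<close>

lemma Cg0_infnorm_le:
  fixes \<phi> :: "real \<Rightarrow> real ^ 'n::finite"
  assumes g: "phase_weight g" and \<phi>: "\<phi> \<in> Cg0 g" and "s \<le> 0"
  shows "infnorm (\<phi> s) \<le> gnorm g \<phi> * g s"
proof -
  let ?q = "\<lambda>s. infnorm (\<phi> s) / g s"
  have g1: "1 \<le> g s" if "s \<le> 0" for s using g that by (auto simp: phase_weight_def)
  have "\<forall>\<^sub>F s in at_bot. ?q s < 1"
    using \<phi> by (intro order_tendstoD(2)) (auto simp: Cg0_def)
  then obtain B where B: "\<And>s. s \<le> B \<Longrightarrow> ?q s < 1" by (auto simp: eventually_at_bot_linorder)
  have "continuous_on {B..0} ?q"
  proof (rule continuous_on_divide)
    have "continuous_on {..0} \<phi>" using \<phi> by (simp add: Cg0_def)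
    then have "continuous_on {B..0} \<phi>" by (rule continuous_on_subset) auto
    then show "continuous_on {B..0} (\<lambda>s. infnorm (\<phi> s))"
      by (auto simp: continuous_on_eq_continuous_within intro!: continuous_infnorm)
    show "continuous_on {B..0} g"
      by (rule continuous_on_subset[of "{..0}" g]) (use g in \<open>auto simp: phase_weight_def\<close>)
    show "\<forall>x\<in>{B..0}. g x \<noteq> 0" using g1 by force
  qed
  then have "bdd_above (?q ` {B..0})"
    by (intro bounded_imp_bdd_above compact_imp_bounded compact_continuous_image) auto
  then obtain M where M: "\<And>s. s \<in> {B..0} \<Longrightarrow> ?q s \<le> M"
    unfolding bdd_above_def by blast
  have "bdd_above (?q ` {..0})"
  proof (rule bdd_aboveI2)
    fix s :: real assume "s \<in> {..0}"
    then show "?q s \<le> max 1 M" using B[of s] M[of s] by (cases "s \<le> B") auto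
  qed
  then have "?q s \<le> gnorm g \<phi>"
    unfolding gnorm_def using \<open>s \<le> 0\<close> by (intro cSUP_upper) auto
  then show ?thesis using g1[OF \<open>s \<le> 0\<close>] by (simp add: pos_divide_le_eq)
qed

lemma gnorm_le:
  assumes g: "phase_weight g" and "\<And>s. s \<le> 0 \<Longrightarrow> infnorm (\<phi> s) \<le> M * g s"
  shows "gnorm g \<phi> \<le> M"
  unfolding gnorm_def
proof (rule cSUP_least)
  fix s :: real assume "s \<in> {..0}"
  moreover from this have "1 \<le> g s" using g by (auto simp: phase_weight_def)
  ultimately show "infnorm (\<phi> s) / g s \<le> M" using assms(2)[of s] by (simp add: pos_divide_le_eq)
qed simp

lemma infnorm_le_cart: "(\<And>i. \<bar>x $ i\<bar> \<le> c) \<Longrightarrow> infnorm (x :: real ^ 'n::finite) \<le> c"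
  unfolding infnorm_cart by (rule cSup_least) auto

lemma fde_solution_continuous:
  assumes sol: "fde_solution F \<sigma> \<phi> x" and \<phi>: "\<phi> \<in> Cg0 g"
  shows "continuous_on UNIV x"
proof -
  have "continuous_on {..\<sigma>} x"
  proof (rule continuous_on_eq)
    show "continuous_on {..\<sigma>} (\<lambda>t. \<phi> (t - \<sigma>))"
    proof (rule continuous_on_compose2[of "{..0}" \<phi> "{..\<sigma>}" "\<lambda>t. t - \<sigma>"])
      show "continuous_on {..0} \<phi>" using \<phi> by (simp add: Cg0_def)
    qed (auto intro!: continuous_on_diff continuous_on_id continuous_on_const)
    fix t assume "t \<in> {..\<sigma>}"
    moreover have "hist x \<sigma> (t - \<sigma>) = \<phi> (t - \<sigma>)" if "t \<le> \<sigma>"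
      using sol that by (simp add: fde_solution_def)
    ultimately show "\<phi> (t - \<sigma>) = x t" by (simp add: hist_def)
  qed
  moreover have "continuous_on {\<sigma>..} x"
    using sol by (intro continuous_on_vector_derivative) (auto simp: fde_solution_def)
  ultimately have "continuous_on ({..\<sigma>} \<union> {\<sigma>..}) x"
    by (intro continuous_on_closed_Un) auto
  moreover have "{..\<sigma>} \<union> {\<sigma>..} = UNIV" by auto
  ultimately show ?thesis by simp
qed

lemma has_integral_primitive:
  fixes e :: "real \<Rightarrow> real"
  assumes "\<And>b c. e integrable_on {b..c}" "0 \<le> x" "x \<le> y"
  shows "(e has_integral integral {0..y} e - integral {0..x} e) {x..y}"
proof -
  have "integral {0..x} e + integral {x..y} e = integral {0..y} e"
    using assms by (intro Henstock_Kurzweil_Integration.integral_combine) auto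
  then have "integral {0..y} e - integral {0..x} e = integral {x..y} e" by simp
  with integrable_integral[OF assms(1)[of x y]] show ?thesis by metis
qed

lemma primitive_mono:
  fixes e :: "real \<Rightarrow> real"
  assumes "\<And>b c. e integrable_on {b..c}" "\<And>t. 0 \<le> e t" "0 \<le> x" "x \<le> y"
  shows "integral {0..x} e \<le> integral {0..y} e"
  using has_integral_nonneg[OF has_integral_primitive[OF assms(1,3,4)]] assms(2) by simp

lemma continuous_on_primitive:
  fixes e :: "real \<Rightarrow> real"
  assumes "\<And>b c. e integrable_on {b..c}"
  shows "continuous_on {0..} (\<lambda>t. integral {0..t} e)"
  unfolding continuous_on_eq_continuous_within
proof
  fix t :: real assume "t \<in> {0..}"
  moreover have "continuous_on {0..t + 1} (\<lambda>t. integral {0..t} e)"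
    by (rule indefinite_integral_continuous_1[OF assms])
  ultimately have "continuous (at t within {0..t + 1}) (\<lambda>t. integral {0..t} e)"
    by (auto simp: continuous_on_eq_continuous_within)
  moreover have "at t within {0..t + 1} = at t within {0..}"
    by (rule at_within_nhd[of _ "{..<t + 1}"]) auto
  ultimately show "continuous (at t within {0..}) (\<lambda>t. integral {0..t} e)" by simp
qed

lemma primitive_at_top:
  fixes e :: "real \<Rightarrow> real"
  assumes int: "\<And>b c. e absolutely_integrable_on {b..c}" and nonneg: "\<And>t. 0 \<le> e t"
    and meas: "e \<in> borel_measurable lebesgue"
    and inf: "(\<integral>\<^sup>+ t\<in>{0..}. ennreal (e t) \<partial>lebesgue) = \<infinity>"
  shows "filterlim (\<lambda>t. integral {0..t} e) at_top at_top"
proof -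
  let ?E = "\<lambda>t. integral {0..t} e"
  have HK: "e integrable_on {b..c}" for b c
    using int by (rule set_lebesgue_integral_eq_integral(1))
  have mono: "?E s \<le> ?E t" if "0 \<le> s" "s \<le> t" for s t
    using that by (intro primitive_mono HK nonneg)
  have eq: "(\<integral>\<^sup>+ t\<in>{0..real n}. ennreal (e t) \<partial>lebesgue) = ennreal (?E (real n))" for n
  proof -
    have "(\<integral>\<^sup>+ t. ennreal (indicator {0..real n} t *\<^sub>R e t) \<partial>lebesgue) = ennreal (LINT t:{0..real n}|lebesgue. e t)"
      unfolding set_lebesgue_integral_def
      using int[of 0 "real n"] nonneg by (intro nn_integral_eq_integral) (auto simp: set_integrable_def)
    also have "(LINT t:{0..real n}|lebesgue. e t) = ?E (real n)"
      using int by (rule set_lebesgue_integral_eq_integral(2))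
    also have "(\<integral>\<^sup>+ t. ennreal (indicator {0..real n} t *\<^sub>R e t) \<partial>lebesgue) = (\<integral>\<^sup>+ t\<in>{0..real n}. ennreal (e t) \<partial>lebesgue)"
      by (intro nn_integral_cong) (auto simp: indicator_def)
    finally show ?thesis .
  qed
  have "(SUP n. \<integral>\<^sup>+ t\<in>{0..real n}. ennreal (e t) \<partial>lebesgue) = (\<integral>\<^sup>+ t. (SUP n. ennreal (e t) * indicator {0..real n} t) \<partial>lebesgue)"
  proof (rule nn_integral_monotone_convergence_SUP[symmetric])
    show "incseq (\<lambda>n t. ennreal (e t) * indicator {0..real n} t)"
      by (auto simp: incseq_def le_fun_def indicator_def)
    show "(\<lambda>t. ennreal (e t) * indicator {0..real n} t) \<in> borel_measurable lebesgue" for n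
      by (intro borel_measurable_times_ennreal measurable_compose[OF meas measurable_ennreal]
          borel_measurable_indicator) simp
  qed
  also have "\<dots> = (\<integral>\<^sup>+ t\<in>{0..}. ennreal (e t) \<partial>lebesgue)"
  proof (intro nn_integral_cong)
    fix t :: real
    obtain N where N: "t < real N" using reals_Archimedean2 by blast
    show "(SUP n. ennreal (e t) * indicator {0..real n} t) = ennreal (e t) * indicator {0..} t"
    proof (rule antisym)
      show "(SUP n. ennreal (e t) * indicator {0..real n} t) \<le> ennreal (e t) * indicator {0..} t"
        by (intro SUP_least mult_left_mono) (auto simp: indicator_def)
      show "ennreal (e t) * indicator {0..} t \<le> (SUP n. ennreal (e t) * indicator {0..real n} t)"
        by (rule SUP_upper2[of N]) (use N in \<open>auto simp: indicator_def\<close>)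
    qed
  qed
  finally have top: "(SUP n. ennreal (?E (real n))) = \<infinity>" using inf eq by simp
  show ?thesis
    unfolding filterlim_at_top
  proof
    fix Z :: real
    have "ennreal Z < (SUP n. ennreal (?E (real n)))" unfolding top by simp
    then obtain n where "ennreal Z < ennreal (?E (real n))" by (auto simp: less_SUP_iff)
    then have "Z \<le> ?E (real n)" by (meson ennreal_leI leD le_cases)
    then have "Z \<le> ?E t" if "real n \<le> t" for t
      using mono[of "real n" t] that by simp
    then show "\<forall>\<^sub>F t in at_top. Z \<le> ?E t" by (auto simp: eventually_at_top_linorder)
  qed
qed

section \<open>Decay of solutions\<close>

text \<open>
  The delayed terms are abstracted to functionals bounded by \<open>a\<^sub>i\<^sub>j(t)\<close> times a maximum over the
  delay window. If \<open>\<bar>x\<^sub>j\<bar> \<le> v\<^sub>j C e\<^bsup>-E\<^esup>\<close> on \<open>[0, t]\<close>, then on the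
  window \<open>[t - r(t), t]\<close> the bound is at most \<open>v\<^sub>j q c\<close> with \<open>c = C e\<^bsup>-E(t)\<^esup>\<close> and \<open>q = e\<^bsup>E(t) - E(t - r(t))\<^esup>\<close>,
  because \<open>E\<close> is nondecreasing; this is where the exponential factor in the dominance condition
  comes from.
\<close>

lemma system_decay:
  fixes x :: "real \<Rightarrow> real ^ 'n::finite" and v :: "real ^ 'n" and a d :: "'n \<Rightarrow> 'n \<Rightarrow> real \<Rightarrow> real"
    and L :: "'n \<Rightarrow> 'n \<Rightarrow> real \<Rightarrow> (real \<Rightarrow> real) \<Rightarrow> real" and r :: "real \<Rightarrow> real"
  assumes "0 \<le> \<sigma>" and v: "\<And>i. 0 < v $ i"
    and contx: "continuous_on {0..} x"
    and sol: "\<And>t. \<sigma> \<le> t \<Longrightarrow> (x has_vector_derivative system_rhs d L t (hist x t)) (at t within {\<sigma>..})"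
    and d: "\<And>i. continuous_on {\<sigma>..} (d i i)"
    and e: "\<And>b c. e absolutely_integrable_on {b..c}" and e_nonneg: "\<And>t. 0 \<le> e t"
    and r: "\<And>t. \<sigma> \<le> t \<Longrightarrow> 0 \<le> r t" "\<And>t. \<sigma> \<le> t \<Longrightarrow> r t \<le> t"
    and L: "\<And>i j t C \<psi>. \<sigma> \<le> t \<Longrightarrow> 0 \<le> C \<Longrightarrow> (\<And>s. s \<in> {- r t..0} \<Longrightarrow> \<bar>\<psi> s\<bar> \<le> C) \<Longrightarrow>
      \<bar>L i j t \<psi>\<bar> \<le> a i j t * C"
    and dominance: "\<And>i t. \<sigma> \<le> t \<Longrightarrow>
      (\<Sum>j\<in>- {i}. \<bar>d i j t\<bar> * v $ j) + exp (integral {t - r t..t} e) * (\<Sum>j\<in>UNIV. a i j t * v $ j)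
        + e t * v $ i \<le> d i i t * v $ i"
    and "0 \<le> K"
    and init: "\<And>j s. 0 \<le> s \<Longrightarrow> s \<le> \<sigma> \<Longrightarrow> \<bar>x s $ j\<bar> \<le> v $ j * K * exp (- integral {0..s} e)"
    and "\<sigma> \<le> t"
  shows "\<bar>x t $ i\<bar> \<le> v $ i * K * exp (- integral {0..t} e)"
proof -
  define E where "E s = integral {0..s} e" for s
  have HK: "e integrable_on {b..c}" for b c
    using e by (rule set_lebesgue_integral_eq_integral(1))
  have E: "(e has_integral E y - E x) {x..y}" if "0 \<le> x" "x \<le> y" for x y
    unfolding E_def using has_integral_primitive[OF HK that] .
  have E_mono: "E s \<le> E t" if "0 \<le> s" "s \<le> t" for s t
    unfolding E_def using that by (intro primitive_mono HK e_nonneg)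
  define R where "R i t = - (\<Sum>j\<in>- {i}. d i j t * x t $ j) + (\<Sum>j\<in>UNIV. L i j t (\<lambda>s. hist x t s $ j))" for i t
  have rhs: "system_rhs d L t (hist x t) $ i = R i t - d i i t * x t $ i" for i t
    using sum.remove[of UNIV i "\<lambda>j. d i j t * x t $ j"]
    by (simp add: system_rhs_def R_def hist_def Compl_eq_Diff_UNIV)
  have "\<bar>x t $ i\<bar> \<le> v $ i * K * exp (- E t)"
  proof (rule weighted_bound[where X = "\<lambda>i t. x t $ i" and R = R and d = "\<lambda>i. d i i" and e = e and \<sigma> = \<sigma>])
    show "((\<lambda>t. x t $ i) has_real_derivative R i t - d i i t * x t $ i) (at t within {\<sigma>..})"
      if "\<sigma> \<le> t" for i t
      using bounded_linear.has_vector_derivative[OF bounded_linear_vec_nth sol[OF that], of i]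
      by (simp add: rhs has_real_derivative_iff_has_vector_derivative)
    show "continuous_on {0..} E" unfolding E_def by (rule continuous_on_primitive[OF HK])
    show "\<bar>R i t\<bar> \<le> (d i i t - e t) * (v $ i * C * exp (- E t))"
      if "\<sigma> \<le> t" "0 \<le> C" and X: "\<And>j s. 0 \<le> s \<Longrightarrow> s \<le> t \<Longrightarrow> \<bar>x s $ j\<bar> \<le> v $ j * C * exp (- E s)"
      for i t C
    proof -
      define c where "c = C * exp (- E t)"
      define q where "q = exp (integral {t - r t..t} e)"
      have "0 \<le> c" "0 \<le> t" using that \<open>0 \<le> \<sigma>\<close> by (auto simp: c_def)
      have "E t - E (t - r t) = integral {t - r t..t} e"
        using r[OF that(1)] by (intro integral_unique[symmetric] E) auto
      then have qc: "C * exp (- E (t - r t)) = q * c"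
        by (simp add: q_def c_def exp_add[symmetric] flip: mult.assoc mult.commute[of C])
      have "\<bar>L i j t (\<lambda>s. hist x t s $ j)\<bar> \<le> a i j t * (v $ j * (q * c))" for j
      proof (rule L[OF that(1)])
        show "0 \<le> v $ j * (q * c)" using v[of j] \<open>0 \<le> c\<close> by (simp add: q_def)
        fix s assume s: "s \<in> {- r t..0}"
        then have "\<bar>x (t + s) $ j\<bar> \<le> v $ j * C * exp (- E (t + s))"
          using r[OF that(1)] by (intro X) auto
        also have "\<dots> \<le> v $ j * C * exp (- E (t - r t))"
          using s r[OF that(1)] v[of j] \<open>0 \<le> C\<close> by (intro mult_left_mono) (auto intro: E_mono)
        finally show "\<bar>hist x t s $ j\<bar> \<le> v $ j * (q * c)" by (simp add: hist_def qc[symmetric] mult.assoc)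
      qed
      then have "\<bar>\<Sum>j\<in>UNIV. L i j t (\<lambda>s. hist x t s $ j)\<bar> \<le> (\<Sum>j\<in>UNIV. a i j t * (v $ j * (q * c)))"
        by (intro order_trans[OF sum_abs] sum_mono)
      also have "\<dots> = c * (q * (\<Sum>j\<in>UNIV. a i j t * v $ j))"
        by (simp add: sum_distrib_left algebra_simps)
      finally have delayed: "\<bar>\<Sum>j\<in>UNIV. L i j t (\<lambda>s. hist x t s $ j)\<bar> \<le> \<dots>" .
      have "\<bar>\<Sum>j\<in>- {i}. d i j t * x t $ j\<bar> \<le> (\<Sum>j\<in>- {i}. \<bar>d i j t\<bar> * (v $ j * c))"
        using X[OF \<open>0 \<le> t\<close> order_refl]
        by (intro order_trans[OF sum_abs] sum_mono) (auto simp: abs_mult c_def mult.assoc intro!: mult_left_mono)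
      also have "\<dots> = c * (\<Sum>j\<in>- {i}. \<bar>d i j t\<bar> * v $ j)"
        by (simp add: sum_distrib_left algebra_simps)
      finally have "\<bar>R i t\<bar> \<le> c * ((\<Sum>j\<in>- {i}. \<bar>d i j t\<bar> * v $ j) + q * (\<Sum>j\<in>UNIV. a i j t * v $ j))"
        using delayed unfolding R_def distrib_left by linarith
      also have "\<dots> \<le> c * (d i i t * v $ i - e t * v $ i)"
        using dominance[OF that(1), of i] \<open>0 \<le> c\<close> by (intro mult_left_mono) (auto simp: q_def)
      finally show ?thesis by (simp add: c_def algebra_simps)
    qed
  qed (use assms E in \<open>auto intro!: continuous_intros simp: E_def\<close>)
  then show ?thesis by (simp add: E_def)
qed

lemma delay_le_max_delay: "\<tau> i j t \<le> max_delay \<tau> t"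
proof -
  have "{\<tau> i j t | i j. True} = (\<lambda>(i, j). \<tau> i j t) ` UNIV" by auto
  then have "finite {\<tau> i j t | i j. True}" by simp
  then show ?thesis unfolding max_delay_def by (intro Max_ge) auto
qed

lemma weighted_row_dominance:
  assumes "0 \<le> ((D_hat d t - q *\<^sub>R coeff_matrix a t - \<epsilon> *\<^sub>R mat 1) *v v) $ i"
  shows "(\<Sum>j\<in>- {i}. \<bar>d i j t\<bar> * v $ j) + q * (\<Sum>j\<in>UNIV. a i j t * v $ j) + \<epsilon> * v $ i \<le> d i i t * v $ i"
proof -
  have D: "(\<Sum>j\<in>UNIV. D_hat d t $ i $ j * v $ j) = d i i t * v $ i - (\<Sum>j\<in>- {i}. \<bar>d i j t\<bar> * v $ j)"
  proof -
    have "(\<Sum>j\<in>- {i}. D_hat d t $ i $ j * v $ j) = (\<Sum>j\<in>- {i}. - (\<bar>d i j t\<bar> * v $ j))"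
      by (intro sum.cong) (auto simp: D_hat_def)
    then show ?thesis
      using sum.remove[of UNIV i "\<lambda>j. D_hat d t $ i $ j * v $ j"]
      by (simp add: D_hat_def Compl_eq_Diff_UNIV sum_negf)
  qed
  have "(\<epsilon> *\<^sub>R mat 1 *v v) $ i = \<epsilon> * v $ i"
    by (simp add: scaleR_matrix_vector_assoc[symmetric])
  moreover have "(q *\<^sub>R coeff_matrix a t *v v) $ i = q * (\<Sum>j\<in>UNIV. a i j t * v $ j)"
    by (simp add: scaleR_matrix_vector_assoc[symmetric] matrix_vector_mult_def coeff_matrix_def
        sum_distrib_left mult.assoc)
  moreover have "(D_hat d t *v v) $ i = (\<Sum>j\<in>UNIV. D_hat d t $ i $ j * v $ j)"
    by (simp add: matrix_vector_mult_def)
  ultimately show ?thesis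
    using assms unfolding matrix_vector_mult_diff_rdistrib D by simp
qed

theorem theorem3p3:
  fixes g :: "real \<Rightarrow> real"
    and d a \<tau> :: "'n::finite \<Rightarrow> 'n \<Rightarrow> real \<Rightarrow> real"
    and \<nu> :: "'n \<Rightarrow> 'n \<Rightarrow> real \<Rightarrow> real \<Rightarrow> real"
    and e :: "real \<Rightarrow> real" and v :: "real ^ 'n" and T :: real
  assumes g: "phase_weight g"
    and tau_cont: "\<And>i j. continuous_on {0..} (\<tau> i j)"
    and tau_nonneg: "\<And>i j t. 0 \<le> t \<Longrightarrow> 0 \<le> \<tau> i j t"
    and d_cont: "\<And>i j. continuous_on {0..} (d i j)"
    and a_nonneg: "\<And>i j t. 0 \<le> t \<Longrightarrow> 0 \<le> a i j t"
    and L_cont: "\<And>i j. dual_continuous g (delay_op (a i j) (\<tau> i j) (\<nu> i j))"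
    and nu_bv: "\<And>i j t. 0 \<le> t \<Longrightarrow> bounded_variation_on UNIV (\<nu> i j t)"
    and nu_normalized:
      "\<And>i j t. 0 \<le> t \<Longrightarrow> (LINT s:{- \<tau> i j t..0}|variation_measure (\<nu> i j t). g s) = 1"
    and tau_le: "\<forall>\<^sub>F t in at_top. max_delay \<tau> t \<le> t"
    and e_meas: "e \<in> borel_measurable lebesgue"
    and e_nonneg: "\<And>t. 0 \<le> e t"
    and e_loc_int: "\<And>b c. set_integrable lebesgue {b..c} e"
    and v_pos: "\<And>i. 0 < v $ i"
    and T_nonneg: "0 \<le> T"
    and cond_i:
      "\<And>t i. T \<le> t \<Longrightarrow>
        0 \<le> ((D_hat d t
              - exp (LINT u:{t - max_delay \<tau> t..t}|lebesgue. e u) *\<^sub>R coeff_matrix a t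
              - e t *\<^sub>R mat 1) *v v) $ i"
    and cond_ii: "(\<integral>\<^sup>+ t\<in>{0..}. ennreal (e t) \<partial>lebesgue) = \<infinity>"
  shows "asymptotically_stable g
           (system_rhs d (\<lambda>i j. delay_op (a i j) (\<tau> i j) (\<nu> i j)))"
proof -
  let ?F = "system_rhs d (\<lambda>i j. delay_op (a i j) (\<tau> i j) (\<nu> i j))"
  define E where "E t = integral {0..t} e" for t
  have HK: "e integrable_on {b..c}" for b c
    using e_loc_int by (rule set_lebesgue_integral_eq_integral(1))
  have E_mono: "E s \<le> E t" if "0 \<le> s" "s \<le> t" for s t
    unfolding E_def using that by (intro primitive_mono HK e_nonneg)
  obtain T0 where T0: "\<And>t. T0 \<le> t \<Longrightarrow> max_delay \<tau> t \<le> t"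
    using tau_le by (auto simp: eventually_at_top_linorder)
  define \<alpha> where "\<alpha> = max T T0"
  have \<alpha>: "0 \<le> \<alpha>" "T \<le> \<alpha>" "T0 \<le> \<alpha>" using T_nonneg by (auto simp: \<alpha>_def)
  have g1: "1 \<le> g s" if "s \<le> 0" for s using g that by (simp add: phase_weight_def)
  have g_anti: "g t \<le> g s" if "s \<le> t" "t \<le> 0" for s t
    using g that by (auto simp: phase_weight_def monotone_on_def)
  define m where "m = Min (range (\<lambda>i. v $ i))"
  have m: "0 < m" "m \<le> v $ i" for i using v_pos by (auto simp: m_def)
  \<comment> \<open>\<open>\<sigma>\<close> may exceed the initial time \<open>\<sigma>0\<close>: a solution started before \<open>\<alpha>\<close> is taken up at \<open>\<alpha>\<close>.\<close>
  have decay: "\<bar>x t $ i\<bar> \<le> v $ i * K * exp (- E t)"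
    if sol: "fde_solution ?F \<sigma>0 \<phi> x" and \<phi>: "\<phi> \<in> Cg0 g" and \<sigma>: "\<sigma>0 \<le> \<sigma>" "\<alpha> \<le> \<sigma>" and "0 \<le> K"
      and init: "\<And>j s. 0 \<le> s \<Longrightarrow> s \<le> \<sigma> \<Longrightarrow> \<bar>x s $ j\<bar> \<le> m * K * exp (- E \<sigma>)" and "\<sigma> \<le> t"
    for \<sigma>0 \<sigma> \<phi> x K t i
    unfolding E_def
  proof (rule system_decay[where \<sigma> = \<sigma> and r = "max_delay \<tau>" and e = e and d = d and a = a
        and L = "\<lambda>i j. delay_op (a i j) (\<tau> i j) (\<nu> i j)"])
    show "continuous_on {0..} x"
      using fde_solution_continuous[OF sol \<phi>] by (rule continuous_on_subset) simp
    show "(x has_vector_derivative ?F t (hist x t)) (at t within {\<sigma>..})" if "\<sigma> \<le> t" for t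
      by (rule has_vector_derivative_within_subset[where S = "{\<sigma>0..}"])
         (use sol that \<sigma> in \<open>auto simp: fde_solution_def\<close>)
    show "continuous_on {\<sigma>..} (d i i)" for i
      using \<sigma> \<alpha> by (intro continuous_on_subset[OF d_cont]) auto
    show "0 \<le> max_delay \<tau> t" if "\<sigma> \<le> t" for t
      using tau_nonneg[of t undefined undefined] delay_le_max_delay[of \<tau> undefined undefined t] that \<sigma> \<alpha> by linarith
    show "max_delay \<tau> t \<le> t" if "\<sigma> \<le> t" for t using T0 that \<sigma> \<alpha> by simp
    show "\<bar>delay_op (a i j) (\<tau> i j) (\<nu> i j) t \<psi>\<bar> \<le> a i j t * C"
      if "\<sigma> \<le> t" "0 \<le> C" "\<And>s. s \<in> {- max_delay \<tau> t..0} \<Longrightarrow> \<bar>\<psi> s\<bar> \<le> C" for i j t C \<psi>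
    proof (rule abs_delay_op_le[OF g])
      show "\<bar>\<psi> s\<bar> \<le> C" if "s \<in> {- \<tau> i j t..0}" for s
        using that delay_le_max_delay[of \<tau> i j t] by (intro \<open>\<And>s. s \<in> _ \<Longrightarrow> \<bar>\<psi> s\<bar> \<le> C\<close>) auto
    qed (use that \<sigma> \<alpha> nu_bv nu_normalized a_nonneg in auto)
    show "(\<Sum>j\<in>- {i}. \<bar>d i j t\<bar> * v $ j) + exp (integral {t - max_delay \<tau> t..t} e) * (\<Sum>j\<in>UNIV. a i j t * v $ j)
        + e t * v $ i \<le> d i i t * v $ i" if "\<sigma> \<le> t" for i t
      using weighted_row_dominance[OF cond_i[of t i]] that \<sigma> \<alpha>
      by (simp add: set_lebesgue_integral_eq_integral(2)[OF e_loc_int])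
    show "\<bar>x s $ j\<bar> \<le> v $ j * K * exp (- integral {0..s} e)" if "0 \<le> s" "s \<le> \<sigma>" for j s
    proof -
      have "m * K * exp (- E \<sigma>) \<le> v $ j * K * exp (- E s)"
        using m v_pos[of j] \<open>0 \<le> K\<close> E_mono[OF that] by (intro mult_mono) auto
      then show ?thesis using init[OF that, of j] by (simp add: E_def)
    qed
  qed (use \<sigma> \<alpha> that v_pos e_loc_int e_nonneg in auto)

  have "stable_from g ?F \<alpha>"
    unfolding stable_from_def
  proof (intro allI impI)
    fix \<epsilon> \<sigma> :: real assume "0 < \<epsilon>" "\<alpha> \<le> \<sigma>"
    then have "0 \<le> \<sigma>" using \<alpha> by simp
    \<comment> \<open>On \<open>[0, \<sigma>]\<close> the solution is at most \<open>g (- \<sigma>)\<close> times the norm of the initial function, which is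
      the initial bound in \<open>decay\<close> with \<open>K\<close> equal to \<open>A\<close> times this norm.\<close>
    define A where "A = g (- \<sigma>) * exp (E \<sigma>) / m"
    define M where "M = max 1 ((\<Sum>i\<in>UNIV. v $ i) * A)"
    have "0 < A" using g1[of "- \<sigma>"] \<open>0 \<le> \<sigma>\<close> m by (simp add: A_def)
    have "1 \<le> M" by (simp add: M_def)
    have "gnorm g (hist x t) < \<epsilon>"
      if \<phi>: "\<phi> \<in> Cg0 g" and small: "gnorm g \<phi> < \<epsilon> / M" and sol: "fde_solution ?F \<sigma> \<phi> x" and "\<sigma> \<le> t"
      for \<phi> x t
    proof -
      let ?N = "gnorm g \<phi>"
      have \<phi>_le: "infnorm (\<phi> s) \<le> ?N * g s" if "s \<le> 0" for s
        using Cg0_infnorm_le[OF g \<phi> that] .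
      have "0 \<le> ?N * g 0" using infnorm_pos_le[of "\<phi> 0"] \<phi>_le[of 0] by linarith
      then have N: "0 \<le> ?N" using g by (simp add: phase_weight_def)
      have past: "infnorm (x s) \<le> ?N * g (s - \<sigma>)" if "s \<le> \<sigma>" for s
      proof -
        have "hist x \<sigma> (s - \<sigma>) = \<phi> (s - \<sigma>)" using sol that by (simp add: fde_solution_def)
        with \<phi>_le[of "s - \<sigma>"] that show ?thesis by (simp add: hist_def)
      qed
      have future: "infnorm (x s) \<le> M * ?N" if "\<sigma> \<le> s" for s
      proof (rule infnorm_le_cart)
        fix i
        have "\<bar>x s $ i\<bar> \<le> v $ i * (A * ?N) * exp (- E s)"
        proof (rule decay[OF sol \<phi> order_refl \<open>\<alpha> \<le> \<sigma>\<close> _ _ that])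
          show "0 \<le> A * ?N" using \<open>0 < A\<close> N by simp
          fix j r assume "0 \<le> r" "r \<le> \<sigma>"
          have "\<bar>x r $ j\<bar> \<le> ?N * g (r - \<sigma>)"
            using component_le_infnorm_cart past[OF \<open>r \<le> \<sigma>\<close>] by (rule order_trans)
          also have "\<dots> \<le> ?N * g (- \<sigma>)"
            using \<open>0 \<le> r\<close> \<open>r \<le> \<sigma>\<close> N by (intro mult_left_mono g_anti) auto
          also have "\<dots> = m * (A * ?N) * exp (- E \<sigma>)"
            using m by (simp add: A_def exp_minus field_simps)
          finally show "\<bar>x r $ j\<bar> \<le> m * (A * ?N) * exp (- E \<sigma>)" .
        qed
        also have "\<dots> \<le> (\<Sum>i\<in>UNIV. v $ i) * (A * ?N) * 1"
        proof (intro mult_mono)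
          show "v $ i \<le> (\<Sum>i\<in>UNIV. v $ i)"
            by (rule member_le_sum) (auto simp: v_pos less_imp_le)
          have "E 0 \<le> E s" using that \<open>0 \<le> \<sigma>\<close> by (intro E_mono) auto
          then show "exp (- E s) \<le> 1" by (simp add: E_def)
        qed (use \<open>0 < A\<close> N v_pos in \<open>auto intro!: mult_nonneg_nonneg sum_nonneg simp: less_imp_le\<close>)
        also have "\<dots> \<le> M * ?N"
          using N by (simp add: M_def mult.assoc[symmetric] mult_right_mono)
        finally show "\<bar>x s $ i\<bar> \<le> M * ?N" .
      qed
      have "gnorm g (hist x t) \<le> M * ?N"
      proof (rule gnorm_le[OF g])
        fix s :: real assume "s \<le> 0"
        show "infnorm (hist x t s) \<le> M * ?N * g s"
        proof (cases "\<sigma> \<le> t + s")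
          case True
          have "M * ?N * 1 \<le> M * ?N * g s"
            using g1[OF \<open>s \<le> 0\<close>] \<open>1 \<le> M\<close> N by (intro mult_left_mono) auto
          then show ?thesis using future[OF True] by (simp add: hist_def)
        next
          case False
          \<comment> \<open>Shifting the initial function into the past only lowers its weighted size: \<open>g\<close> is nonincreasing.\<close>
          have "?N * g (t + s - \<sigma>) \<le> ?N * g s"
            using False \<open>\<sigma> \<le> t\<close> N by (intro mult_left_mono g_anti) auto
          also have "\<dots> \<le> M * (?N * g s)"
            using \<open>1 \<le> M\<close> N g1[OF \<open>s \<le> 0\<close>] mult_right_mono[of 1 M "?N * g s"] by simp
          finally show ?thesis using past[of "t + s"] False by (simp add: hist_def mult.assoc)
        qed
      qed
      also have "\<dots> < \<epsilon>" using small \<open>1 \<le> M\<close> by (simp add: pos_less_divide_eq mult.commute)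
      finally show ?thesis .
    qed
    moreover have "0 < \<epsilon> / M" using \<open>0 < \<epsilon>\<close> \<open>1 \<le> M\<close> by simp
    ultimately show "\<exists>\<delta>>0. \<forall>\<phi>\<in>Cg0 g. gnorm g \<phi> < \<delta> \<longrightarrow>
        (\<forall>x. fde_solution ?F \<sigma> \<phi> x \<longrightarrow> (\<forall>t\<ge>\<sigma>. gnorm g (hist x t) < \<epsilon>))"
      by blast
  qed
  moreover have "(x \<longlongrightarrow> 0) at_top"
    if "0 \<le> \<sigma>0" and \<phi>: "\<phi> \<in> Cg0 g" and sol: "fde_solution ?F \<sigma>0 \<phi> x" for \<sigma>0 \<phi> x
  proof -
    define \<sigma> where "\<sigma> = max \<sigma>0 \<alpha>"
    have "continuous_on {0..\<sigma>} x"
      using fde_solution_continuous[OF sol \<phi>] by (rule continuous_on_subset) simp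
    then have "bounded (x ` {0..\<sigma>})"
      by (intro compact_imp_bounded compact_continuous_image) auto
    then obtain N where N: "0 < N" "\<And>s. s \<in> {0..\<sigma>} \<Longrightarrow> norm (x s) \<le> N"
      by (auto simp: bounded_pos)
    define K where "K = N * exp (E \<sigma>) / m"
    have bound: "\<bar>x t $ i\<bar> \<le> v $ i * K * exp (- E t)" if "\<sigma> \<le> t" for t i
    proof (rule decay[OF sol \<phi> _ _ _ _ that])
      show "0 \<le> K" using N m by (simp add: K_def)
      show "\<bar>x s $ j\<bar> \<le> m * K * exp (- E \<sigma>)" if "0 \<le> s" "s \<le> \<sigma>" for j s
        using N(2)[of s] that component_le_norm_cart[of "x s" j] m by (simp add: K_def exp_minus field_simps)
    qed (auto simp: \<sigma>_def)
    have "filterlim E at_top at_top"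
      unfolding E_def using e_loc_int e_nonneg e_meas cond_ii by (rule primitive_at_top)
    then have exp0: "((\<lambda>t. exp (- E t)) \<longlongrightarrow> 0) at_top"
      by (intro filterlim_compose[OF exp_at_bot] filterlim_compose[OF filterlim_uminus_at_bot_at_top])
    show ?thesis
    proof (rule vec_tendstoI)
      fix i
      have "((\<lambda>t. v $ i * K * exp (- E t)) \<longlongrightarrow> 0) at_top"
        using tendsto_mult_right_zero[OF exp0] .
      then have "((\<lambda>t. x t $ i) \<longlongrightarrow> 0) at_top"
        by (rule Lim_null_comparison[rotated])
           (use bound in \<open>auto simp: eventually_at_top_linorder\<close>)
      then show "((\<lambda>t. x t $ i) \<longlongrightarrow> 0 $ i) at_top" by simp
    qed
  qed
  ultimately show ?thesis
    unfolding asymptotically_stable_def using \<alpha>(1) by blast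
qed

end
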